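(* Let $g = p^+g^+ + p^-g^- \in \mathcal{D}'(\partial D, \mathbb{B})$. The bicomplex Dirichlet problem for $f: D\to\mathbb{B}$, \[ \begin{cases} \partial \bar\partial f = 0 \ \text{ in } D,\\ f_b = g, \end{cases} \] where $f_b$ is the distributional boundary value of $f$, is uniquely solved by \[ f(re^{i\theta}) = p^+ \frac{1}{2\pi} \langle g^+, P_r(\theta - \cdot) \rangle + p^- \frac{1}{2\pi} \langle g^-, P_r(\theta - \cdot) \rangle. \]
   Context: $D$ is the open unit disk in $\mathbb{C}$ and $\partial D$ is the unit circle. $P_r(\theta) = \frac{1-r^2}{1-2r\cos\theta + r^2}$ is the Poisson kernel. The bicomplex numbers $\mathbb{B}$ are $\mathbb{C}^2$ with the usual addition and scalar multiplication and with the commutative product $(z_1,z_2)(w_1,w_2) = (z_1w_1 - z_2w_2,\, z_1w_2+z_2w_1)$; one writes $(z_1,z_2) = z_1 + j z_2$, so $j^2=-1$ and $j$ commutes with $i$. Put $p^\pm := \frac12(1 \pm ji)\in\mathbb{B}$. Every $z\in\mathbb{B}$ has a unique representation $z = p^+ z^+ + p^- z^-$ with $z^\pm\in\mathbb{C}$; for a $\mathbb{B}$-valued function $h$, the complex-valued functions $h^\pm$ are the components in this representation. $\mathcal{D}'(\partial D,\mathbb{B})$ is the set of distributions $h$ on $\partial D$ with bicomplex values, i.e. $\langle h,\varphi\rangle\in\mathbb{B}$ for $\varphi\in C^\infty(\partial D)$; such $h$ is written $h = p^+h^+ + p^-h^-$ with $h^\pm$ complex-valued distributions in $\mathcal{D}'(\partial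 D)$. A function $h$ on $D$ has a boundary value in the sense of distributions $h_b$ if for every $\gamma\in C^\infty(\partial D)$ the limit $\langle h_b,\gamma\rangle=\lim_{r\nearrow1}\int_0^{2\pi}h(re^{i\theta})\gamma(\theta)\,d\theta$ exists. The bicomplex operators are $\partial := p^+\frac{\partial}{\partial \bar z} + p^-\frac{\partial}{\partial z}$ and $\bar\partial := p^+\frac{\partial}{\partial z} + p^-\frac{\partial}{\partial \bar z}$, where $\frac{\partial}{\partial z},\frac{\partial}{\partial\bar z}$ are the complex Wirtinger derivatives; one has $4\partial\bar\partial=\Delta$, the Laplacian. *)

theory Defs
  imports "HOL-Analysis.Analysis"
begin

subsection \<open>Bicomplex numbers\<close>

text \<open>The pair \<open>(z1, z2)\<close> stands for \<open>z1 + j z2\<close>. Addition, real scaling, norm and topology are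
  those of the product type; the type class product is not available on pairs, so the bicomplex
  product is a separate operation. Complex scalar multiplication is multiplication by
  \<open>bc c\<close>, see \<open>bc_mult_bc\<close> below.\<close>

type_synonym bicomplex = "complex \<times> complex"

definition bc_mult :: "bicomplex \<Rightarrow> bicomplex \<Rightarrow> bicomplex" (infixl "*\<^sub>B" 70) where
  "z *\<^sub>B w = (fst z * fst w - snd z * snd w, fst z * snd w + snd z * fst w)"

definition bc :: "complex \<Rightarrow> bicomplex" where
  "bc c = (c, 0)"

definition bc_j :: bicomplex where
  "bc_j = (0, 1)"

definition p_plus :: bicomplex where
  "p_plus = bc (1/2) *\<^sub>B (bc 1 + bc_j *\<^sub>B bc \<i>)"

definition p_minus :: bicomplex where
  "p_minus = bc (1/2) *\<^sub>B (bc 1 - bc_j *\<^sub>B bc \<i>)"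

definition plus_part :: "bicomplex \<Rightarrow> complex" where
  "plus_part z = (THE a. \<exists>b. z = p_plus *\<^sub>B bc a + p_minus *\<^sub>B bc b)"

definition minus_part :: "bicomplex \<Rightarrow> complex" where
  "minus_part z = (THE b. \<exists>a. z = p_plus *\<^sub>B bc a + p_minus *\<^sub>B bc b)"

lemma bc_mult_bc: "bc c *\<^sub>B (z1, z2) = (c * z1, c * z2)"
  by (simp add: bc_mult_def bc_def)

lemma idempotent_representation_iff:
  "z = p_plus *\<^sub>B bc a + p_minus *\<^sub>B bc b \<longleftrightarrow>
     a = fst z - \<i> * snd z \<and> b = fst z + \<i> * snd z"
proof -
  obtain u v where z: "z = (u, v)" by (cases z)
  have "z = p_plus *\<^sub>B bc a + p_minus *\<^sub>B bc b \<longleftrightarrow> 2 * u = a + b \<and> 2 * v = \<i> * a - \<i> * b"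
    by (auto simp: z p_plus_def p_minus_def bc_mult_def bc_def bc_j_def field_simps)
  also have "\<dots> \<longleftrightarrow> a = u - \<i> * v \<and> b = u + \<i> * v"
    by (auto simp: complex_eq_iff)
  finally show ?thesis by (simp add: z)
qed

lemma plus_part_eq: "plus_part z = fst z - \<i> * snd z"
  unfolding plus_part_def idempotent_representation_iff by simp

lemma minus_part_eq: "minus_part z = fst z + \<i> * snd z"
  unfolding minus_part_def idempotent_representation_iff by simp

lemma idempotent_representation:
  "z = p_plus *\<^sub>B bc (plus_part z) + p_minus *\<^sub>B bc (minus_part z)"
  by (simp add: idempotent_representation_iff plus_part_eq minus_part_eq)


subsection \<open>Test functions and bicomplex distributions on the unit circle\<close>

text \<open>A function on the circle is identified with a \<open>2\<pi>\<close>-periodic function of the angle, and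
  test functions are complex valued.\<close>

definition nderiv :: "nat \<Rightarrow> (real \<Rightarrow> complex) \<Rightarrow> real \<Rightarrow> complex" where
  "nderiv k \<phi> = ((\<lambda>\<psi> t. vector_derivative \<psi> (at t)) ^^ k) \<phi>"

definition circle_test :: "(real \<Rightarrow> complex) set" where
  "circle_test = {\<phi>. (\<forall>t. \<phi> (t + 2 * pi) = \<phi> t) \<and> (\<forall>k t. nderiv k \<phi> differentiable (at t))}"

definition Ck_norm :: "nat \<Rightarrow> (real \<Rightarrow> complex) \<Rightarrow> real" where
  "Ck_norm N \<phi> = (\<Sum>k\<le>N. SUP t. cmod (nderiv k \<phi> t))"

text \<open>Complex-linear functionals that are continuous for the Frechet topology given by the
  seminorms \<open>Ck_norm N\<close>. Values outside \<open>circle_test\<close> are irrelevant.\<close>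

definition bc_distribution :: "((real \<Rightarrow> complex) \<Rightarrow> bicomplex) \<Rightarrow> bool" where
  "bc_distribution h \<longleftrightarrow>
     (\<forall>\<phi>\<in>circle_test. \<forall>\<psi>\<in>circle_test. h (\<lambda>t. \<phi> t + \<psi> t) = h \<phi> + h \<psi>) \<and>
     (\<forall>c. \<forall>\<phi>\<in>circle_test. h (\<lambda>t. c * \<phi> t) = bc c *\<^sub>B h \<phi>) \<and>
     (\<exists>C N. \<forall>\<phi>\<in>circle_test. norm (h \<phi>) \<le> C * Ck_norm N \<phi>)"

text \<open>The integral is required to exist for \<open>r\<close> close to \<open>1\<close>, since \<open>integral\<close> takes a default
  value on non-integrable functions.\<close>

definition has_boundary_value ::
    "(complex \<Rightarrow> bicomplex) \<Rightarrow> ((real \<Rightarrow> complex) \<Rightarrow> bicomplex) \<Rightarrow> bool" where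
  "has_boundary_value h hb \<longleftrightarrow>
     (\<forall>\<gamma>\<in>circle_test.
        (\<forall>\<^sub>F r in at_left 1.
           (\<lambda>\<theta>. h (of_real r * cis \<theta>) *\<^sub>B bc (\<gamma> \<theta>)) absolutely_integrable_on {0..2*pi}) \<and>
        ((\<lambda>r. integral {0..2*pi} (\<lambda>\<theta>. h (of_real r * cis \<theta>) *\<^sub>B bc (\<gamma> \<theta>)))
            \<longlongrightarrow> hb \<gamma>) (at_left 1))"


subsection \<open>The bicomplex operators and the Dirichlet problem\<close>

definition partial_x :: "(complex \<Rightarrow> bicomplex) \<Rightarrow> complex \<Rightarrow> bicomplex" where
  "partial_x f z = vector_derivative (\<lambda>t. f (z + of_real t)) (at 0)"

definition partial_y :: "(complex \<Rightarrow> bicomplex) \<Rightarrow> complex \<Rightarrow> bicomplex" where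
  "partial_y f z = vector_derivative (\<lambda>t. f (z + \<i> * of_real t)) (at 0)"

definition wirtinger_z :: "(complex \<Rightarrow> bicomplex) \<Rightarrow> complex \<Rightarrow> bicomplex" where
  "wirtinger_z f z = bc (1/2) *\<^sub>B (partial_x f z - bc \<i> *\<^sub>B partial_y f z)"

definition wirtinger_zbar :: "(complex \<Rightarrow> bicomplex) \<Rightarrow> complex \<Rightarrow> bicomplex" where
  "wirtinger_zbar f z = bc (1/2) *\<^sub>B (partial_x f z + bc \<i> *\<^sub>B partial_y f z)"

definition bc_del :: "(complex \<Rightarrow> bicomplex) \<Rightarrow> complex \<Rightarrow> bicomplex" where
  "bc_del f z = p_plus *\<^sub>B wirtinger_zbar f z + p_minus *\<^sub>B wirtinger_z f z"

definition bc_delbar :: "(complex \<Rightarrow> bicomplex) \<Rightarrow> complex \<Rightarrow> bicomplex" where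
  "bc_delbar f z = p_plus *\<^sub>B wirtinger_z f z + p_minus *\<^sub>B wirtinger_zbar f z"

definition C2_on :: "complex set \<Rightarrow> (complex \<Rightarrow> bicomplex) \<Rightarrow> bool" where
  "C2_on S f \<longleftrightarrow>
     (\<exists>(f' :: complex \<Rightarrow> complex \<Rightarrow>\<^sub>L bicomplex)
       (f'' :: complex \<Rightarrow> complex \<Rightarrow>\<^sub>L complex \<Rightarrow>\<^sub>L bicomplex).
        (\<forall>z\<in>S. (f has_derivative blinfun_apply (f' z)) (at z)) \<and>
        (\<forall>z\<in>S. (f' has_derivative blinfun_apply (f'' z)) (at z)) \<and>
        continuous_on S f'')"

text \<open>Solutions are classical, i.e. twice continuously differentiable in the open disk. Only the
  values of \<open>f\<close> on \<open>ball 0 1\<close> matter.\<close>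

definition bc_dirichlet_solution ::
    "((real \<Rightarrow> complex) \<Rightarrow> bicomplex) \<Rightarrow> (complex \<Rightarrow> bicomplex) \<Rightarrow> bool" where
  "bc_dirichlet_solution g f \<longleftrightarrow>
     C2_on (ball 0 1) f \<and>
     (\<forall>z\<in>ball 0 1. bc_del (bc_delbar f) z = 0) \<and>
     has_boundary_value f g"

definition poisson_kernel :: "real \<Rightarrow> real \<Rightarrow> real" where
  "poisson_kernel r \<theta> = (1 - r\<^sup>2) / (1 - 2 * r * cos \<theta> + r\<^sup>2)"

end

theory Submission
  imports Defs "HOL-Complex_Analysis.Cauchy_Integral_Formula"
begin

text \<open>
  In the coordinates given by the idempotents \<open>p_plus\<close> and \<open>p_minus\<close> the bicomplex
  problem splits into two unrelated complex ones. The product becomes coordinatewise, and the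
  operator \<open>bc_del \<circ> bc_delbar\<close> acts on the plus part as the Wirtinger derivative
  \<open>\<partial>/\<partial>z\<close> followed by its conjugate, and in the opposite order on the minus part. Either way
  the equation says that each part is harmonic, and the boundary condition passes to each part,
  whose boundary datum is a complex distribution \<open>L\<close> on the circle.

  For one complex distribution everything is read off from Fourier coefficients. Continuity of
  \<open>L\<close> makes \<open>L (osc m)\<close> grow at most polynomially in \<open>m\<close>, where
  \<open>osc m t = exp (i m t)\<close>. On the other side, the coefficients of a test function, and the
  coefficients \<open>r ^ \<bar>m\<bar>\<close> of the Poisson kernel, decay faster than every power, and for such
  coefficients \<open>L\<close> may be applied term by term (\<open>distribution_series\<close>). Hence \<open>L\<close> applied to
  the Poisson kernel equals \<open>2 * pi\<close> times the series \<open>poisson_extension\<close>, the sum of a power series in \<open>z\<close>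
  and one in the conjugate of \<open>z\<close>, which is smooth and harmonic. Its integral over the circle of
  radius \<open>r\<close> against a test function \<open>\<gamma>\<close> is an absolutely convergent series in powers
  of \<open>r\<close>. By Abel's theorem the limit \<open>r \<rightarrow> 1\<close> is the same series at \<open>r = 1\<close>, and this is
  \<open>L \<gamma>\<close> because \<open>\<gamma>\<close> is the sum of its Fourier series (\<open>poisson_extension_boundary\<close>).
  The Fourier inversion needed here follows from the completeness of the trigonometric system
  (\<open>null_spectrum_imp_zero\<close>), a consequence of the Stone--Weierstrass theorem.

  For uniqueness, a \<open>C\<^sup>2\<close> harmonic \<open>u\<close> on the disk has a holomorphic derivative
  \<open>\<partial>u/\<partial>z\<close>. Subtracting a primitive of it leaves an antiholomorphic function, so
  \<open>u\<close> is again a power series in \<open>z\<close> plus one in the conjugate of \<open>z\<close>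
  (\<open>harmonic_decomposition\<close>). Integrating over circles against \<open>osc m\<close> isolates
  the terms of a single frequency, as a constant times \<open>r ^ \<bar>m\<bar>\<close>, so the boundary value determines the series
  (\<open>disk_series_unique\<close>).
\<close>

section \<open>Oscillations and rapidly decaying coefficients\<close>

definition osc :: "int \<Rightarrow> real \<Rightarrow> complex" where
  "osc m t = cis (of_int m * t)"

lemma norm_osc [simp]: "cmod (osc m t) = 1"
  by (simp add: osc_def)

lemma osc_0 [simp]: "osc 0 t = 1"
  by (simp add: osc_def)

lemma osc_mult: "osc m t * osc n t = osc (m + n) t"
  by (simp add: osc_def cis_mult algebra_simps)

lemma osc_period [simp]: "osc m (t + 2 * pi) = osc m t"
proof -
  have "cis (of_int m * (t + 2 * pi)) = cis (of_int m * t) * cis (2 * pi * of_int m)"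
    by (simp add: cis_mult algebra_simps)
  then show ?thesis by (simp add: osc_def cis_multiple_2pi)
qed

lemma continuous_on_osc [continuous_intros]: "continuous_on S (osc m)"
  unfolding osc_def by (intro continuous_intros)

lemma osc_has_vector_derivative:
  "(osc m has_vector_derivative \<i> * of_int m * osc m t) (at t)"
proof -
  have "((\<lambda>t. exp (\<i> * of_int m * t)) has_vector_derivative \<i> * of_int m * exp (\<i> * of_int m * t)) (at t)"
    by (rule has_vector_derivative_real_field) (auto intro!: derivative_eq_intros)
  then show ?thesis by (simp add: osc_def[abs_def] cis_conv_exp mult.assoc)
qed

lemma integral_osc:
  "integral {0..2*pi} (osc m) = (if m = 0 then 2 * pi else 0)"
proof (cases "m = 0")
  case True
  have "(osc m) = (\<lambda>_. 1)" using True by auto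
  then show ?thesis using True by (simp add: content_real scaleR_conv_of_real)
next
  case False
  have "((\<lambda>t. osc m t) has_integral (osc m (2*pi) / (\<i> * of_int m) - osc m 0 / (\<i> * of_int m))) {0..2*pi}"
  proof (rule fundamental_theorem_of_calculus)
    fix t :: real
    have "((\<lambda>t. osc m t / (\<i> * of_int m)) has_vector_derivative
        \<i> * of_int m * osc m t / (\<i> * of_int m)) (at t within {0..2*pi})"
      by (intro has_vector_derivative_divide has_vector_derivative_at_within[OF osc_has_vector_derivative])
    then show "((\<lambda>t. osc m t / (\<i> * of_int m)) has_vector_derivative osc m t) (at t within {0..2*pi})"
      using False by simp
  qed simp
  moreover have "osc m (2*pi) = osc m 0" using osc_period[of m 0] by simp
  ultimately show ?thesis using False by (simp add: integral_unique)
qed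

text \<open>Decay faster than every power of the index. The base \<open>Suc n\<close> keeps the weight at least
  \<open>1\<close>, so that the weights increase with the exponent and still see the entry at \<open>0\<close>.\<close>
definition rapid :: "(nat \<Rightarrow> complex) \<Rightarrow> bool" where
  "rapid c \<longleftrightarrow> (\<forall>k. summable (\<lambda>n. cmod (c n) * real (Suc n) ^ k))"

lemma rapidD: "rapid c \<Longrightarrow> summable (\<lambda>n. cmod (c n) * real (Suc n) ^ k)"
  by (simp add: rapid_def)

lemma rapid_imp_summable_norm: "rapid c \<Longrightarrow> summable (\<lambda>n. cmod (c n))"
  using rapidD[of c 0] by simp

lemma rapid_mult:
  assumes "rapid c" and d: "\<And>n. cmod (d n) \<le> C * real (Suc n) ^ j"
  shows "rapid (\<lambda>n. c n * d n)"
  unfolding rapid_def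
proof
  fix k
  show "summable (\<lambda>n. cmod (c n * d n) * real (Suc n) ^ k)"
  proof (rule summable_comparison_test'[where g = "\<lambda>n. C * (cmod (c n) * real (Suc n) ^ (k+j))" and N = 0])
    show "summable (\<lambda>n. C * (cmod (c n) * real (Suc n) ^ (k+j)))"
      by (intro summable_mult rapidD assms)
    fix n
    have "cmod (c n) * cmod (d n) * real (Suc n) ^ k \<le> cmod (c n) * (C * real (Suc n) ^ j) * real (Suc n) ^ k"
      by (intro mult_right_mono mult_left_mono d) auto
    then show "norm (cmod (c n * d n) * real (Suc n) ^ k) \<le> C * (cmod (c n) * real (Suc n) ^ (k+j))"
      by (simp add: norm_mult power_add algebra_simps del: of_nat_Suc)
  qed
qed

lemma rapid_mono:
  assumes "rapid c" and "\<And>n. cmod (d n) \<le> cmod (c n)"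
  shows "rapid d"
  unfolding rapid_def
proof
  fix k
  show "summable (\<lambda>n. cmod (d n) * real (Suc n) ^ k)"
    using assms(2)
    by (intro summable_comparison_test'[OF rapidD[OF assms(1), of k], of 0])
       (auto intro!: mult_right_mono simp: abs_mult)
qed

text \<open>Boundedness suffices, since the bound for the exponent \<open>k + 2\<close> leaves a summable factor
  \<open>1 / (Suc n)\<^sup>2\<close> for the exponent \<open>k\<close>.\<close>
lemma rapid_if_bounded:
  assumes "\<And>k. \<exists>B. \<forall>n. cmod (c n) * real (Suc n) ^ k \<le> B"
  shows "rapid c"
  unfolding rapid_def
proof
  fix k
  obtain B where B: "\<And>n. cmod (c n) * real (Suc n) ^ (k + 2) \<le> B"
    using assms by blast
  have s: "summable (\<lambda>n. B * inverse (real (Suc n) ^ 2))"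
    by (intro summable_mult iffD2[OF summable_Suc_iff] inverse_power_summable) auto
  show "summable (\<lambda>n. cmod (c n) * real (Suc n) ^ k)"
  proof (rule summable_comparison_test'[OF s])
    fix n :: nat
    have "cmod (c n) * real (Suc n) ^ k * real (Suc n) ^ 2 \<le> B"
      using B[of n] by (simp add: power_add power2_eq_square mult_ac del: of_nat_Suc)
    then have "cmod (c n) * real (Suc n) ^ k \<le> B / real (Suc n) ^ 2"
      by (subst pos_le_divide_eq) auto
    then show "norm (cmod (c n) * real (Suc n) ^ k) \<le> B * inverse (real (Suc n) ^ 2)"
      by (simp add: divide_inverse abs_mult del: of_nat_Suc)
  qed
qed

text \<open>Termwise differentiation of a power series preserves its radius of convergence, and it
  multiplies the coefficients by the index, so \<open>k\<close> differentiations of the geometric series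
  produce the weight of order \<open>k\<close>.\<close>
lemma rapid_geometric:
  assumes "cmod z < 1"
  shows "rapid (\<lambda>n. z ^ n)"
  unfolding rapid_def
proof
  fix k
  have "summable (\<lambda>n. real (Suc n) ^ k * x ^ n)" if "norm x < 1" for x :: real
    using that
  proof (induction k arbitrary: x)
    case 0
    then show ?case by (simp add: summable_geometric)
  next
    case (Suc k)
    have "summable (\<lambda>n. diffs (\<lambda>n. real n ^ k) n * x ^ n)"
    proof (rule termdiff_converges[OF Suc.prems])
      fix y :: real assume "norm y < 1"
      then have "summable (\<lambda>n. y * (real (Suc n) ^ k * y ^ n))"
        by (intro summable_mult Suc.IH)
      then have "summable (\<lambda>n. real (Suc n) ^ k * y ^ Suc n)"
        by (simp add: mult_ac)
      then show "summable (\<lambda>n. real n ^ k * y ^ n)"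
        by (subst (asm) summable_Suc_iff)
    qed
    then show ?case by (simp add: diffs_def)
  qed
  from this[of "cmod z"] show "summable (\<lambda>n. cmod (z ^ n) * real (Suc n) ^ k)"
    using assms by (simp add: norm_power mult.commute)
qed

text \<open>The frequencies are given by an arbitrary sequence \<open>m\<close>, so that the same lemmas serve the
  half of a Fourier series with nonnegative frequencies and the half with nonpositive ones.\<close>
lemma uniform_limit_osc_series:
  assumes "summable (\<lambda>n. cmod (c n))"
  shows "uniform_limit S (\<lambda>N t. \<Sum>n<N. c n * osc (m n) t) (\<lambda>t. \<Sum>n. c n * osc (m n) t) sequentially"
  by (rule Weierstrass_m_test[OF _ assms]) (simp add: norm_mult)

lemma osc_series_sums:
  assumes "summable (\<lambda>n. cmod (c n))"
  shows "(\<lambda>n. c n * osc (m n) t) sums (\<Sum>n. c n * osc (m n) t)"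
  by (rule summable_sums, rule summable_norm_cancel) (simp add: norm_mult assms)

lemma continuous_on_osc_series:
  assumes "summable (\<lambda>n. cmod (c n))"
  shows "continuous_on S (\<lambda>t. \<Sum>n. c n * osc (m n) t)"
  by (rule uniform_limit_theorem[OF _ uniform_limit_osc_series[OF assms]])
     (auto intro!: always_eventually continuous_intros)

lemma integral_osc_series:
  assumes "summable (\<lambda>n. cmod (c n))" and \<psi>: "continuous_on {0..2*pi} \<psi>"
  shows "(\<lambda>n. c n * integral {0..2*pi} (\<lambda>t. osc (m n) t * \<psi> t)) sums
           integral {0..2*pi} (\<lambda>t. (\<Sum>n. c n * osc (m n) t) * \<psi> t)"
proof -
  obtain B where B: "\<And>t. t \<in> {0..2*pi} \<Longrightarrow> cmod (\<psi> t) \<le> B"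
    using compact_imp_bounded[OF compact_continuous_image[OF \<psi> compact_Icc]]
    unfolding bounded_iff by (meson imageI)
  have "uniform_limit {0..2*pi} (\<lambda>N t. \<Sum>n<N. c n * osc (m n) t * \<psi> t)
          (\<lambda>t. \<Sum>n. c n * osc (m n) t * \<psi> t) sequentially"
    by (rule Weierstrass_m_test[OF _ summable_mult2[OF assms(1), of B]])
       (auto simp: norm_mult intro!: mult_left_mono B)
  moreover have "(\<Sum>n. c n * osc (m n) t * \<psi> t) = (\<Sum>n. c n * osc (m n) t) * \<psi> t" for t
    by (rule suminf_mult2[symmetric]) (use osc_series_sums[OF assms(1)] in \<open>auto simp: sums_iff\<close>)
  ultimately have *: "uniform_limit {0..2*pi} (\<lambda>N t. \<Sum>n<N. c n * osc (m n) t * \<psi> t)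
          (\<lambda>t. (\<Sum>n. c n * osc (m n) t) * \<psi> t) sequentially" by simp
  obtain I J where I: "\<And>N. ((\<lambda>t. \<Sum>n<N. c n * osc (m n) t * \<psi> t) has_integral I N) {0..2*pi}"
    and J: "((\<lambda>t. (\<Sum>n. c n * osc (m n) t) * \<psi> t) has_integral J) {0..2*pi}" and IJ: "I \<longlonglongrightarrow> J"
    by (rule uniform_limit_integral[OF *]) (auto intro!: continuous_intros \<psi>)
  have "I N = (\<Sum>n<N. c n * integral {0..2*pi} (\<lambda>t. osc (m n) t * \<psi> t))" for N
  proof -
    have "I N = integral {0..2*pi} (\<lambda>t. \<Sum>n<N. c n * osc (m n) t * \<psi> t)"
      using I[of N] by (simp add: integral_unique)
    also have "\<dots> = (\<Sum>n<N. integral {0..2*pi} (\<lambda>t. c n * osc (m n) t * \<psi> t))"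
      by (intro integral_sum integrable_continuous_real continuous_intros \<psi>) auto
    finally show ?thesis by (simp add: mult.assoc)
  qed
  then have "I = (\<lambda>N. \<Sum>n<N. c n * integral {0..2*pi} (\<lambda>t. osc (m n) t * \<psi> t))" by (rule ext)
  then show ?thesis using IJ integral_unique[OF J] by (simp only: sums_def)
qed

text \<open>The bound \<open>\<bar>m n\<bar> \<le> int n\<close> ties the frequency to the index, so that a derivative costs one
  power of the weight in \<open>rapid\<close>.\<close>
lemma osc_series_has_vector_derivative:
  assumes "rapid c" and m: "\<And>n. \<bar>m n\<bar> \<le> int n"
  shows "((\<lambda>t. \<Sum>n. c n * osc (m n) t) has_vector_derivative
           (\<Sum>n. c n * (\<i> * of_int (m n)) * osc (m n) t)) (at t)"
proof -
  have m': "cmod (\<i> * of_int (m n)) \<le> 1 * real (Suc n) ^ 1" for n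
    using m[of n] by (simp add: norm_mult)
  have d: "summable (\<lambda>n. cmod (c n * (\<i> * of_int (m n))))"
    by (intro rapid_imp_summable_norm rapid_mult[OF assms(1) m'])
  have c: "summable (\<lambda>n. cmod (c n))" by (rule rapid_imp_summable_norm[OF assms(1)])
  note ul = uniform_limit_osc_series[OF d, where S = UNIV and m = m]
  have "\<exists>g. \<forall>x\<in>UNIV. (\<lambda>n. c n * osc (m n) x) sums g x \<and>
     (g has_derivative (\<lambda>h. h *\<^sub>R (\<Sum>n. c n * (\<i> * of_int (m n)) * osc (m n) x))) (at x within UNIV)"
  proof (rule has_derivative_series[where f' = "\<lambda>n x h. h *\<^sub>R (c n * (\<i> * of_int (m n)) * osc (m n) x)"])
    fix n x
    show "((\<lambda>t. c n * osc (m n) t) has_derivative (\<lambda>h. h *\<^sub>R (c n * (\<i> * of_int (m n)) * osc (m n) x))) (at x within UNIV)"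
      using has_vector_derivative_mult_right[OF osc_has_vector_derivative[of "m n" x], of "c n"]
      by (simp add: has_vector_derivative_def mult.assoc)
  next
    fix e :: real assume e: "0 < e"
    have "\<forall>\<^sub>F N in sequentially. \<forall>x\<in>UNIV. dist (\<Sum>n<N. c n * (\<i> * of_int (m n)) * osc (m n) x)
            (\<Sum>n. c n * (\<i> * of_int (m n)) * osc (m n) x) < e"
      using ul e unfolding uniform_limit_iff by blast
    then show "\<forall>\<^sub>F N in sequentially. \<forall>x\<in>UNIV. \<forall>h. norm ((\<Sum>n<N. h *\<^sub>R (c n * (\<i> * of_int (m n)) * osc (m n) x)) -
            h *\<^sub>R (\<Sum>n. c n * (\<i> * of_int (m n)) * osc (m n) x)) \<le> e * norm h"
    proof eventually_elim
      case (elim N)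
      show ?case
      proof (intro ballI allI)
        fix x h :: real
        have "norm ((\<Sum>n<N. h *\<^sub>R (c n * (\<i> * of_int (m n)) * osc (m n) x)) -
            h *\<^sub>R (\<Sum>n. c n * (\<i> * of_int (m n)) * osc (m n) x))
          = \<bar>h\<bar> * dist (\<Sum>n<N. c n * (\<i> * of_int (m n)) * osc (m n) x)
              (\<Sum>n. c n * (\<i> * of_int (m n)) * osc (m n) x)"
          unfolding scaleR_sum_right[symmetric] scaleR_diff_right[symmetric] norm_scaleR dist_norm ..
        also have "\<dots> \<le> \<bar>h\<bar> * e" by (intro mult_left_mono less_imp_le[OF bspec[OF elim UNIV_I]] abs_ge_zero)
        finally show "norm ((\<Sum>n<N. h *\<^sub>R (c n * (\<i> * of_int (m n)) * osc (m n) x)) -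
            h *\<^sub>R (\<Sum>n. c n * (\<i> * of_int (m n)) * osc (m n) x)) \<le> e * norm h"
          by (simp add: mult.commute)
      qed
    qed
  next
    show "(\<lambda>n. c n * osc (m n) t) sums (\<Sum>n. c n * osc (m n) t)" by (rule osc_series_sums[OF c])
  qed auto
  then obtain g where g: "\<And>x. (\<lambda>n. c n * osc (m n) x) sums g x"
     "\<And>x. (g has_derivative (\<lambda>h. h *\<^sub>R (\<Sum>n. c n * (\<i> * of_int (m n)) * osc (m n) x))) (at x)"
    by auto
  have "g = (\<lambda>t. \<Sum>n. c n * osc (m n) t)" using g(1) by (auto simp: sums_iff)
  with g(2) show ?thesis by (simp add: has_vector_derivative_def)
qed

lemma nderiv_0: "nderiv 0 \<phi> = \<phi>"
  by (simp add: nderiv_def)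

lemma nderiv_Suc: "nderiv (Suc k) \<phi> t = vector_derivative (nderiv k \<phi>) (at t)"
  by (simp add: nderiv_def)

lemma rapid_mult_freq_power:
  assumes "rapid c" and m: "\<And>n. \<bar>m n\<bar> \<le> int n"
  shows "rapid (\<lambda>n. c n * (\<i> * of_int (m n)) ^ k)"
proof (rule rapid_mult[OF assms(1), where C = 1 and j = k])
  fix n
  show "cmod ((\<i> * complex_of_int (m n)) ^ k) \<le> 1 * real (Suc n) ^ k"
    using m[of n] by (auto simp: norm_power norm_mult intro!: power_mono)
qed

lemma nderiv_osc_series:
  assumes c: "rapid c" and m: "\<And>n. \<bar>m n\<bar> \<le> int n"
  shows "nderiv k (\<lambda>t. \<Sum>n. c n * osc (m n) t) = (\<lambda>t. \<Sum>n. c n * (\<i> * of_int (m n)) ^ k * osc (m n) t)"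
proof (induction k)
  case 0
  show ?case by (simp add: nderiv_0)
next
  case (Suc k)
  have "nderiv (Suc k) (\<lambda>t. \<Sum>n. c n * osc (m n) t) t =
     (\<Sum>n. c n * (\<i> * of_int (m n)) ^ k * (\<i> * of_int (m n)) * osc (m n) t)" for t
    unfolding nderiv_Suc Suc
    by (rule vector_derivative_at osc_series_has_vector_derivative[OF rapid_mult_freq_power[OF c m] m])+
  then show ?case by (simp add: fun_eq_iff mult.assoc mult.left_commute)
qed

lemma osc_series_circle_test:
  assumes c: "rapid c" and m: "\<And>n. \<bar>m n\<bar> \<le> int n"
  shows "(\<lambda>t. \<Sum>n. c n * osc (m n) t) \<in> circle_test"
proof -
  have "nderiv k (\<lambda>t. \<Sum>n. c n * osc (m n) t) differentiable (at t)" for k t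
    unfolding nderiv_osc_series[OF c m]
    by (rule differentiableI_vector[OF osc_series_has_vector_derivative[OF rapid_mult_freq_power[OF c m] m]])
  then show ?thesis by (simp add: circle_test_def)
qed

text \<open>Nonnegativity is part of the statement because \<open>Ck_norm\<close> is built from suprema, which
  carry information only for bounded sets of values.\<close>
lemma Ck_norm_osc_series:
  assumes c: "rapid c" and m: "\<And>n. \<bar>m n\<bar> \<le> int n"
  shows "0 \<le> Ck_norm K (\<lambda>t. \<Sum>n. c n * osc (m n) t)"
    and "Ck_norm K (\<lambda>t. \<Sum>n. c n * osc (m n) t) \<le> real (Suc K) * (\<Sum>n. cmod (c n) * real (Suc n) ^ K)"
proof -
  let ?S = "\<lambda>t. \<Sum>n. c n * osc (m n) t"
  let ?B = "\<Sum>n. cmod (c n) * real (Suc n) ^ K"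
  have bound: "cmod (nderiv k ?S t) \<le> ?B" if k: "k \<le> K" for k t
    unfolding nderiv_osc_series[OF c m]
  proof (rule norm_suminf_le[OF _ rapidD[OF c]])
    fix n
    have "\<bar>real_of_int (m n)\<bar> ^ k \<le> real (Suc n) ^ k"
      using m[of n] by (intro power_mono) auto
    also have "\<dots> \<le> real (Suc n) ^ K" using k by (intro power_increasing) auto
    finally show "cmod (c n * (\<i> * of_int (m n)) ^ k * osc (m n) t) \<le> cmod (c n) * real (Suc n) ^ K"
      by (auto simp: norm_mult norm_power intro!: mult_left_mono)
  qed
  have upper: "(SUP t. cmod (nderiv k ?S t)) \<le> ?B" if "k \<le> K" for k
    by (rule cSUP_least, simp, rule bound[OF that])
  then have "Ck_norm K ?S \<le> (\<Sum>k\<le>K. ?B)"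
    unfolding Ck_norm_def by (intro sum_mono) auto
  then show "Ck_norm K ?S \<le> real (Suc K) * ?B" by simp
  have "0 \<le> (SUP t. cmod (nderiv k ?S t))" if "k \<le> K" for k
    by (rule cSUP_upper2[OF bdd_aboveI2[OF bound[OF that]], where x = 0]) auto
  then show "0 \<le> Ck_norm K ?S" unfolding Ck_norm_def by (intro sum_nonneg) auto
qed

section \<open>Completeness of the trigonometric system\<close>

lemma periodic_eq_if_cis_eq:
  assumes per: "\<And>t. D (t + 2*pi) = D t" and "cis s = cis t"
  shows "D s = D t"
proof -
  have shift: "D (u + 2*pi * real n) = D u" for u n
  proof (induction n)
    case (Suc n)
    then show ?case using per[of "u + 2*pi * real n"] by (simp add: algebra_simps)
  qed simp
  from assms(2) have "sin s = sin t \<and> cos s = cos t" by (simp add: complex_eq_iff)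
  then obtain n :: int where n: "s = t + 2*pi * of_int n"
    unfolding sin_cos_eq_iff by blast
  show ?thesis
  proof (cases "n \<ge> 0")
    case True
    then show ?thesis using n shift[of t "nat n"] by simp
  next
    case False
    then have "s + 2*pi * real (nat (- n)) = t" using n by simp
    then show ?thesis using shift[of s "nat (- n)"] by simp
  qed
qed

text \<open>The principal argument is discontinuous on the negative axis and \<open>Arg2pi\<close> on the positive
  one, but a periodic function does not distinguish between them, so that at every point of the
  circle a continuous branch is available.\<close>
lemma continuous_periodic_on_circle:
  fixes D :: "real \<Rightarrow> 'a::topological_space"
  assumes per: "\<And>t. D (t + 2*pi) = D t" and cont: "continuous_on UNIV D"
  obtains d :: "complex \<Rightarrow> 'a"
    where "continuous_on (sphere 0 1) d" "\<And>t. d (cis t) = D t"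
proof
  let ?d = "\<lambda>z. D (Arg z)"
  have eq: "?d z = D (Arg2pi z)" for z
  proof (cases "z = 0")
    case False
    have "is_Arg z (Arg2pi z)" "is_Arg z (Arg z)"
      using Arg2pi[of z] is_Arg_Arg[OF False] by auto
    then have "cis (Arg z) = cis (Arg2pi z)"
      using False unfolding is_Arg_def cis_conv_exp by (metis mult_left_cancel norm_eq_zero of_real_eq_0_iff)
    then show ?thesis by (intro periodic_eq_if_cis_eq[where D = D, OF per])
  qed (simp add: Arg_zero Arg2pi_0)
  have D: "isCont D x" for x
    using cont by (simp add: continuous_on_eq_continuous_at)
  show "continuous_on (sphere 0 1) ?d"
  proof (rule continuous_at_imp_continuous_on, rule ballI)
    fix z :: complex assume "z \<in> sphere 0 1"
    show "isCont ?d z"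
    proof (cases "z \<in> \<real>\<^sub>\<le>\<^sub>0")
      case False
      show ?thesis by (rule continuous_at_compose[OF continuous_at_Arg[OF False] D, unfolded o_def])
    next
      case True
      with \<open>z \<in> sphere 0 1\<close> have "z \<notin> \<real>\<^sub>\<ge>\<^sub>0"
        by (auto simp: complex_nonpos_Reals_iff complex_nonneg_Reals_iff norm_complex_def)
      show ?thesis unfolding eq
        by (rule continuous_at_compose[OF continuous_at_Arg2pi[OF \<open>z \<notin> _\<close>] D, unfolded o_def])
    qed
  qed
  show "?d (cis t) = D t" for t
    by (rule periodic_eq_if_cis_eq[where D = D, OF per]) (simp add: cis_Arg)
qed

definition null_spectrum :: "(real \<Rightarrow> complex) \<Rightarrow> bool" where
  "null_spectrum D \<longleftrightarrow> continuous_on UNIV D \<and> (\<forall>m. integral {0..2*pi} (\<lambda>t. D t * osc m t) = 0)"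

lemma null_spectrum_continuous: "null_spectrum D \<Longrightarrow> continuous_on S D"
  using continuous_on_subset[of UNIV D S] by (auto simp: null_spectrum_def)

lemma null_spectrum_add:
  assumes "null_spectrum D" "null_spectrum E"
  shows "null_spectrum (\<lambda>t. D t + E t)"
proof -
  have int: "(\<lambda>t. F t * osc m t) integrable_on {0..2*pi}" if "null_spectrum F" for F m
    by (intro integrable_continuous_real continuous_on_mult continuous_on_osc null_spectrum_continuous that)
  have "integral {0..2*pi} (\<lambda>t. (D t + E t) * osc m t) = 0" for m
    using assms int[OF assms(1), of m] int[OF assms(2), of m]
    by (simp add: distrib_right integral_add null_spectrum_def)
  moreover have "continuous_on UNIV (\<lambda>t. D t + E t)"
    by (intro continuous_on_add null_spectrum_continuous assms)
  ultimately show ?thesis by (simp add: null_spectrum_def)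
qed

lemma null_spectrum_cmult:
  assumes "null_spectrum D"
  shows "null_spectrum (\<lambda>t. D t * c)"
proof -
  have "integral {0..2*pi} (\<lambda>t. D t * c * osc m t) = integral {0..2*pi} (\<lambda>t. c * (D t * osc m t))" for m
    by (simp add: mult_ac)
  with assms show ?thesis by (auto simp: null_spectrum_def intro!: continuous_intros)
qed

lemma null_spectrum_osc:
  assumes "null_spectrum D"
  shows "null_spectrum (\<lambda>t. D t * osc k t)"
  using assms
  by (auto simp: null_spectrum_def mult.assoc osc_mult intro!: continuous_intros)

text \<open>Quantifying over all \<open>D\<close> makes the property of \<open>p\<close> closed under products: multiply by one
  factor after the other. Only linear \<open>p\<close> remains, and there \<open>p (cis t)\<close> is a combination of
  \<open>osc 1\<close> and \<open>osc (- 1)\<close>, which shift the spectrum.\<close>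
lemma null_spectrum_polynomial:
  assumes "real_polynomial_function p" "null_spectrum D"
  shows "null_spectrum (\<lambda>t. D t * of_real (p (cis t)))"
  using assms
proof (induction p arbitrary: D)
  case (linear f)
  interpret bounded_linear f by fact
  let ?a = "(of_real (f 1) - \<i> * of_real (f \<i>)) / 2" and ?b = "(of_real (f 1) + \<i> * of_real (f \<i>)) / 2"
  have "D t * of_real (f (cis t)) = D t * osc 1 t * ?a + D t * osc (-1) t * ?b" for t
  proof -
    have "cis t = cos t *\<^sub>R 1 + sin t *\<^sub>R \<i>" by (simp add: complex_eq_iff)
    then have "f (cis t) = cos t * f 1 + sin t * f \<i>"
      by (simp only: add scale real_scaleR_def)
    then have "of_real (f (cis t)) = osc 1 t * ?a + osc (-1) t * ?b"
      by (simp add: osc_def complex_eq_iff field_simps)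
    then show ?thesis by (simp only: distrib_left mult.assoc)
  qed
  then show ?case using linear.prems
    by (simp only:) (intro null_spectrum_add null_spectrum_cmult null_spectrum_osc)
next
  case (const c)
  then show ?case by (rule null_spectrum_cmult)
next
  case (add f g)
  show ?case using null_spectrum_add[OF add.IH[OF add.prems]] by (simp add: distrib_left)
next
  case (mult f g)
  show ?case using mult.IH(2)[OF mult.IH(1)[OF mult.prems]] by (simp add: mult.assoc)
qed

text \<open>Completeness of the trigonometric system. The function \<open>D\<close> is orthogonal to all
  polynomials on the circle, hence by Stone--Weierstrass to its own conjugate, so the integral of
  \<open>\<bar>D\<bar>\<^sup>2\<close> vanishes.\<close>
theorem null_spectrum_imp_zero:
  assumes D: "null_spectrum D" and per: "\<And>t. D (t + 2*pi) = D t"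
  shows "D t = 0"
proof -
  have cont: "continuous_on S D" for S by (rule null_spectrum_continuous[OF D])
  obtain d where d: "continuous_on (sphere 0 1) d" "\<And>t. d (cis t) = D t"
    using continuous_periodic_on_circle[where D = D, OF per cont] by metis
  obtain B where B: "\<And>t. t \<in> {0..2*pi} \<Longrightarrow> cmod (D t) \<le> B"
    using compact_imp_bounded[OF compact_continuous_image[OF cont compact_Icc]]
    unfolding bounded_iff by (meson imageI)
  have "B \<ge> 0" using B[of 0] norm_ge_zero[of "D 0"] by (simp del: norm_ge_zero)
  let ?I = "integral {0..2*pi} (\<lambda>t. D t * cnj (D t))"
  have small: "cmod ?I \<le> \<epsilon> * B * (2*pi)" if "\<epsilon> > 0" for \<epsilon>
  proof -
    obtain p where p: "polynomial_function p" "\<And>z. z \<in> sphere 0 1 \<Longrightarrow> cmod (cnj (d z) - p z) < \<epsilon>"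
      using Stone_Weierstrass_polynomial_function[OF compact_sphere continuous_on_cnj[OF d(1)] \<open>\<epsilon> > 0\<close>] by blast
    have Re: "real_polynomial_function (\<lambda>z. Re (p z))" and Im: "real_polynomial_function (\<lambda>z. Im (p z))"
      using p(1) unfolding polynomial_function_def
      by (auto simp: o_def dest: spec[of _ Re] spec[of _ Im] intro: bounded_linear_Re bounded_linear_Im)
    have "null_spectrum (\<lambda>t. D t * of_real (Re (p (cis t))) + D t * of_real (Im (p (cis t))) * \<i>)"
      by (intro null_spectrum_add null_spectrum_cmult null_spectrum_polynomial[OF Re D] null_spectrum_polynomial[OF Im D])
    moreover have "D t * of_real (Re (p (cis t))) + D t * of_real (Im (p (cis t))) * \<i> = D t * p (cis t)" for t
      by (simp add: complex_eq_iff algebra_simps)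
    ultimately have ns: "null_spectrum (\<lambda>t. D t * p (cis t))" by simp
    then have zero: "integral {0..2*pi} (\<lambda>t. D t * p (cis t)) = 0"
      unfolding null_spectrum_def using osc_0 by (metis (no_types, lifting) mult.right_neutral ext)
    have "?I = ?I - integral {0..2*pi} (\<lambda>t. D t * p (cis t))" by (simp add: zero)
    also have "\<dots> = integral {0..2*pi} (\<lambda>t. D t * cnj (D t) - D t * p (cis t))"
      by (intro integral_diff[symmetric] integrable_continuous_real continuous_intros cont null_spectrum_continuous[OF ns])
    also have "cmod \<dots> \<le> \<epsilon> * B * (2*pi - 0)"
    proof (rule integral_bound)
      fix t assume t: "t \<in> {0..2*pi}"
      have "cmod (cnj (D t) - p (cis t)) \<le> \<epsilon>"
        using p(2)[of "cis t"] d(2)[of t] by simp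
      then have "cmod (D t) * cmod (cnj (D t) - p (cis t)) \<le> B * \<epsilon>"
        using B[OF t] \<open>B \<ge> 0\<close> by (intro mult_mono) auto
      then show "cmod (D t * cnj (D t) - D t * p (cis t)) \<le> \<epsilon> * B"
        by (simp add: norm_mult[symmetric] right_diff_distrib mult.commute)
    qed (auto intro!: continuous_intros cont null_spectrum_continuous[OF ns])
    finally show ?thesis by simp
  qed
  have "?I = 0"
  proof (rule ccontr)
    assume "?I \<noteq> 0"
    then have pos: "cmod ?I > 0" by simp
    have q: "0 < B * (2*pi) + 1" using \<open>B \<ge> 0\<close> by (intro add_nonneg_pos) auto
    \<comment> \<open>An \<open>\<epsilon>\<close> for which the bound is smaller than \<open>cmod ?I\<close>; the added \<open>1\<close> covers \<open>B = 0\<close>.\<close>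
    have "cmod ?I \<le> cmod ?I / (B * (2*pi) + 1) * B * (2*pi)"
      using pos q by (intro small) (auto intro: divide_pos_pos)
    also have "\<dots> = cmod ?I * (B * (2*pi) / (B * (2*pi) + 1))" by simp
    also have "\<dots> < cmod ?I * 1"
      using pos q by (intro mult_strict_left_mono) (auto simp: divide_less_eq)
    finally show False by simp
  qed
  have int: "(\<lambda>t. (cmod (D t))\<^sup>2) integrable_on cbox 0 (2*pi)"
    by (auto intro!: integrable_continuous_real continuous_intros cont)
  have "complex_of_real (integral {0..2*pi} (\<lambda>t. (cmod (D t))\<^sup>2)) = integral {0..2*pi} (\<lambda>t. of_real ((cmod (D t))\<^sup>2))"
    using integral_linear[OF int bounded_linear_of_real[where 'a = complex]] by (simp add: o_def)
  also have "\<dots> = ?I" by (simp only: complex_norm_square)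
  finally have "integral {0..2*pi} (\<lambda>t. (cmod (D t))\<^sup>2) = 0" using \<open>?I = 0\<close> by simp
  with int have hi: "((\<lambda>t. (cmod (D t))\<^sup>2) has_integral 0) (cbox 0 (2*pi))"
    by (auto simp: has_integral_integral)
  \<comment> \<open>The vanishing integral gives information on one period only, so \<open>t\<close> is moved there.\<close>
  define s where "s = Arg2pi (cis t)"
  have s: "s \<in> cbox 0 (2*pi)" using Arg2pi[of "cis t"] by (auto simp: s_def)
  have "(cmod (D s))\<^sup>2 = 0"
    by (rule has_integral_0_cbox_imp_0[OF _ _ hi _ s]) (use pi_gt_zero in \<open>auto intro!: continuous_intros cont simp del: pi_gt_zero\<close>)
  moreover have "cis s = cis t"
    using Arg2pi[of "cis t"] by (simp add: s_def is_Arg_def cis_conv_exp)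
  then have "D s = D t" by (rule periodic_eq_if_cis_eq[where D = D, OF per])
  ultimately show ?thesis by simp
qed

section \<open>Fourier series of test functions\<close>

lemma circle_test_periodic: "\<phi> \<in> circle_test \<Longrightarrow> \<phi> (t + 2*pi) = \<phi> t"
  by (simp add: circle_test_def)

lemma circle_test_has_vector_derivative:
  assumes "\<phi> \<in> circle_test"
  shows "(\<phi> has_vector_derivative nderiv 1 \<phi> t) (at t)"
proof -
  have "nderiv 0 \<phi> differentiable (at t)" using assms by (simp add: circle_test_def)
  then show ?thesis by (simp add: nderiv_def vector_derivative_works)
qed

lemma circle_test_continuous: "\<phi> \<in> circle_test \<Longrightarrow> continuous_on S \<phi>"
  by (intro continuous_at_imp_continuous_on ballI
      has_vector_derivative_continuous[OF circle_test_has_vector_derivative])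

lemma circle_test_nderiv:
  assumes "\<phi> \<in> circle_test"
  shows "nderiv 1 \<phi> \<in> circle_test"
proof -
  have "nderiv 1 \<phi> (t + 2*pi) = nderiv 1 \<phi> t" for t
  proof -
    have "((\<phi> \<circ> (\<lambda>t. t + 2*pi)) has_vector_derivative 1 *\<^sub>R nderiv 1 \<phi> (t + 2*pi)) (at t)"
      by (rule vector_diff_chain_at[OF _ circle_test_has_vector_derivative[OF assms]])
         (auto intro!: derivative_eq_intros simp: has_vector_derivative_def)
    moreover have "\<phi> \<circ> (\<lambda>t. t + 2*pi) = \<phi>" using circle_test_periodic[OF assms] by auto
    ultimately show ?thesis
      using circle_test_has_vector_derivative[OF assms, of t] vector_derivative_unique_at by fastforce
  qed
  moreover have "nderiv k (nderiv 1 \<phi>) = nderiv (Suc k) \<phi>" for k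
    by (simp add: nderiv_def funpow_Suc_right del: funpow.simps(2))
  ultimately show ?thesis using assms by (simp add: circle_test_def)
qed

definition fourier_coeff :: "(real \<Rightarrow> complex) \<Rightarrow> int \<Rightarrow> complex" where
  "fourier_coeff \<phi> m = integral {0..2*pi} (\<lambda>t. osc (- m) t * \<phi> t) / (2*pi)"

lemma fourier_coeff_nderiv:
  assumes "\<phi> \<in> circle_test"
  shows "fourier_coeff (nderiv 1 \<phi>) m = \<i> * of_int m * fourier_coeff \<phi> m"
proof -
  have "((\<lambda>t. osc (-m) t * \<phi> t) has_vector_derivative
      (osc (-m) t * nderiv 1 \<phi> t + \<i> * of_int (-m) * osc (-m) t * \<phi> t)) (at t)" for t
    by (rule has_vector_derivative_mult osc_has_vector_derivative circle_test_has_vector_derivative[OF assms])+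
  then have "((\<lambda>t. osc (-m) t * nderiv 1 \<phi> t + \<i> * of_int (-m) * osc (-m) t * \<phi> t) has_integral
      (osc (-m) (2*pi) * \<phi> (2*pi) - osc (-m) 0 * \<phi> 0)) {0..2*pi}"
    by (intro fundamental_theorem_of_calculus) (auto intro: has_vector_derivative_at_within)
  then have "integral {0..2*pi} (\<lambda>t. osc (-m) t * nderiv 1 \<phi> t + (- (\<i> * of_int m)) * (osc (-m) t * \<phi> t)) = 0"
    using osc_period[of "-m" 0] circle_test_periodic[OF assms, of 0] by (simp add: integral_unique mult.assoc)
  moreover have "integral {0..2*pi} (\<lambda>t. osc (-m) t * nderiv 1 \<phi> t + (- (\<i> * of_int m)) * (osc (-m) t * \<phi> t))
     = integral {0..2*pi} (\<lambda>t. osc (-m) t * nderiv 1 \<phi> t) + integral {0..2*pi} (\<lambda>t. (- (\<i> * of_int m)) * (osc (-m) t * \<phi> t))"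
    by (intro integral_add integrable_continuous_real continuous_intros circle_test_continuous circle_test_nderiv assms)
  ultimately have "integral {0..2*pi} (\<lambda>t. osc (-m) t * nderiv 1 \<phi> t) = \<i> * of_int m * integral {0..2*pi} (\<lambda>t. osc (-m) t * \<phi> t)"
    by simp
  then show ?thesis by (simp add: fourier_coeff_def)
qed

text \<open>Integration by parts turns a factor \<open>m\<close> into a derivative of \<open>\<phi>\<close>. The induction uses
  \<open>\<bar>c\<bar> (1 + \<bar>m\<bar>) = \<bar>c\<bar> + \<bar>m c\<bar>\<close>, whose last term is the size of a coefficient of the
  derivative.\<close>
lemma fourier_coeff_decay:
  assumes "\<phi> \<in> circle_test"
  shows "\<exists>B. \<forall>m. cmod (fourier_coeff \<phi> m) * (1 + \<bar>real_of_int m\<bar>) ^ k \<le> B"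
  using assms
proof (induction k arbitrary: \<phi>)
  case 0
  have cont: "continuous_on {0..2*pi} \<phi>" by (rule circle_test_continuous[OF 0])
  obtain B where B: "\<And>t. t \<in> {0..2*pi} \<Longrightarrow> cmod (\<phi> t) \<le> B"
    using compact_imp_bounded[OF compact_continuous_image[OF cont compact_Icc]]
    unfolding bounded_iff by (meson imageI)
  have "cmod (fourier_coeff \<phi> m) \<le> B" for m
  proof -
    have "cmod (integral {0..2*pi} (\<lambda>t. osc (-m) t * \<phi> t)) \<le> B * (2*pi - 0)"
      by (rule integral_bound) (auto intro!: continuous_intros cont B simp: norm_mult)
    then show ?thesis by (simp add: fourier_coeff_def norm_divide norm_mult field_simps)
  qed
  then show ?case by auto
next
  case (Suc k)
  obtain B where B: "\<And>m. cmod (fourier_coeff \<phi> m) * (1 + \<bar>real_of_int m\<bar>) ^ k \<le> B"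
    using Suc.IH[OF Suc.prems] by blast
  obtain B' where B': "\<And>m. cmod (fourier_coeff (nderiv 1 \<phi>) m) * (1 + \<bar>real_of_int m\<bar>) ^ k \<le> B'"
    using Suc.IH[OF circle_test_nderiv[OF Suc.prems]] by blast
  have "cmod (fourier_coeff \<phi> m) * (1 + \<bar>real_of_int m\<bar>) ^ Suc k \<le> B + B'" for m
  proof -
    have "cmod (fourier_coeff \<phi> m) * (1 + \<bar>real_of_int m\<bar>) ^ Suc k
        = cmod (fourier_coeff \<phi> m) * (1 + \<bar>real_of_int m\<bar>) ^ k
          + cmod (fourier_coeff (nderiv 1 \<phi>) m) * (1 + \<bar>real_of_int m\<bar>) ^ k"
      by (simp add: fourier_coeff_nderiv[OF Suc.prems, unfolded One_nat_def] norm_mult algebra_simps)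
    then show ?thesis using B[of m] B'[of m] by linarith
  qed
  then show ?case by blast
qed

lemma rapid_fourier_coeff:
  assumes "\<phi> \<in> circle_test" and m: "\<And>n. \<bar>m n\<bar> = int n"
  shows "rapid (\<lambda>n. fourier_coeff \<phi> (m n))"
proof (rule rapid_if_bounded)
  fix k
  obtain B where B: "\<And>m. cmod (fourier_coeff \<phi> m) * (1 + \<bar>real_of_int m\<bar>) ^ k \<le> B"
    using fourier_coeff_decay[OF assms(1)] by blast
  have "\<bar>real_of_int (m n)\<bar> = real n" for n using m[of n] by linarith
  then have "\<forall>n. cmod (fourier_coeff \<phi> (m n)) * real (Suc n) ^ k \<le> B" using B[of "m _"] by simp
  then show "\<exists>B. \<forall>n. cmod (fourier_coeff \<phi> (m n)) * real (Suc n) ^ k \<le> B" ..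
qed

lemma integral_osc_mult_osc:
  "integral {0..2*pi} (\<lambda>t. osc k t * osc m t) = (if k + m = 0 then 2*pi else 0)"
  using integral_osc[of "k + m"] by (simp add: osc_mult)

text \<open>At \<open>m = 0\<close> both halves contribute, since both contain the constant function.\<close>
lemma two_sided_coefficient:
  fixes a b :: "nat \<Rightarrow> complex"
  assumes a: "summable (\<lambda>n. cmod (a n))" and b: "summable (\<lambda>n. cmod (b n))"
  shows "integral {0..2*pi} (\<lambda>t. ((\<Sum>n. a n * osc (int n) t) + (\<Sum>n. b n * osc (- int n) t)) * osc (- m) t)
       = 2 * pi * ((if m \<ge> 0 then a (nat m) else 0) + (if m \<le> 0 then b (nat (- m)) else 0))"
proof -
  have A: "integral {0..2*pi} (\<lambda>t. (\<Sum>n. a n * osc (int n) t) * osc (- m) t) = (if m \<ge> 0 then 2 * pi * a (nat (m)) else 0)"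
  proof (rule sums_unique2)
    show "(\<lambda>n. a n * integral {0..2*pi} (\<lambda>t. osc (int n) t * osc (- m) t)) sums
        integral {0..2*pi} (\<lambda>t. (\<Sum>n. a n * osc (int n) t) * osc (- m) t)"
      by (rule integral_osc_series[OF a continuous_on_osc])
    have "(\<lambda>n. a n * integral {0..2*pi} (\<lambda>t. osc (int n) t * osc (- m) t)) =
        (\<lambda>n. if n = nat (m) then (if m \<ge> 0 then 2 * pi * a n else 0) else 0)"
      by (auto simp: integral_osc_mult_osc fun_eq_iff)
    then show "(\<lambda>n. a n * integral {0..2*pi} (\<lambda>t. osc (int n) t * osc (- m) t)) sums
        (if m \<ge> 0 then 2 * pi * a (nat (m)) else 0)"
      by (simp only: sums_single[of "nat m" "\<lambda>n. if m \<ge> 0 then 2 * pi * a n else 0"])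
  qed
  have B: "integral {0..2*pi} (\<lambda>t. (\<Sum>n. b n * osc (- int n) t) * osc (- m) t) = (if m \<le> 0 then 2 * pi * b (nat (- m)) else 0)"
  proof (rule sums_unique2)
    show "(\<lambda>n. b n * integral {0..2*pi} (\<lambda>t. osc (- int n) t * osc (- m) t)) sums
        integral {0..2*pi} (\<lambda>t. (\<Sum>n. b n * osc (- int n) t) * osc (- m) t)"
      by (rule integral_osc_series[OF b continuous_on_osc])
    have "(\<lambda>n. b n * integral {0..2*pi} (\<lambda>t. osc (- int n) t * osc (- m) t)) =
        (\<lambda>n. if n = nat (- m) then (if m \<le> 0 then 2 * pi * b n else 0) else 0)"
      by (auto simp: integral_osc_mult_osc fun_eq_iff)
    then show "(\<lambda>n. b n * integral {0..2*pi} (\<lambda>t. osc (- int n) t * osc (- m) t)) sums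
        (if m \<le> 0 then 2 * pi * b (nat (- m)) else 0)"
      by (simp only: sums_single[of "nat (- m)" "\<lambda>n. if m \<le> 0 then 2 * pi * b n else 0"])
  qed
  show ?thesis unfolding distrib_right
    by (subst integral_add)
       (auto simp: A B distrib_left intro!: integrable_continuous_real continuous_on_mult
          continuous_on_osc continuous_on_osc_series a b)
qed

text \<open>The sum of the Fourier series has the coefficients of \<open>\<phi>\<close>, so the difference has a null
  spectrum. The constant term is assigned to the second half, to match the convention of
  \<open>pos_coeff\<close> and \<open>neg_coeff\<close>.\<close>
theorem fourier_inversion:
  assumes \<phi>: "\<phi> \<in> circle_test"
  shows "\<phi> t = (\<Sum>n. (if n = 0 then 0 else fourier_coeff \<phi> (int n)) * osc (int n) t)
             + (\<Sum>n. fourier_coeff \<phi> (- int n) * osc (- int n) t)"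
proof -
  define a where "a n = (if n = 0 then 0 else fourier_coeff \<phi> (int n))" for n
  define b where "b n = fourier_coeff \<phi> (- int n)" for n
  define S where "S t = (\<Sum>n. a n * osc (int n) t) + (\<Sum>n. b n * osc (- int n) t)" for t
  have "rapid a" by (rule rapid_mono[OF rapid_fourier_coeff[OF \<phi>, of int]]) (auto simp: a_def)
  then have a: "summable (\<lambda>n. cmod (a n))" by (rule rapid_imp_summable_norm)
  have "rapid b" unfolding b_def by (rule rapid_fourier_coeff[OF \<phi>]) simp
  then have b: "summable (\<lambda>n. cmod (b n))" by (rule rapid_imp_summable_norm)
  have contS: "continuous_on X S" for X unfolding S_def
    by (intro continuous_on_add continuous_on_osc_series a b)
  have cont: "continuous_on X \<phi>" for X by (rule circle_test_continuous[OF \<phi>])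
  have "integral {0..2*pi} (\<lambda>t. (\<phi> t - S t) * osc m t) = 0" for m
  proof -
    have "integral {0..2*pi} (\<lambda>t. (\<phi> t - S t) * osc m t)
        = integral {0..2*pi} (\<lambda>t. osc (- (- m)) t * \<phi> t) - integral {0..2*pi} (\<lambda>t. S t * osc (- (- m)) t)"
      unfolding left_diff_distrib
      by (subst integral_diff)
         (auto simp: mult.commute intro!: integrable_continuous_real continuous_on_mult continuous_on_osc contS cont)
    also have "integral {0..2*pi} (\<lambda>t. osc (- (- m)) t * \<phi> t) = 2 * pi * fourier_coeff \<phi> (- m)"
      by (simp add: fourier_coeff_def)
    also have "integral {0..2*pi} (\<lambda>t. S t * osc (- (- m)) t) = 2 * pi * fourier_coeff \<phi> (- m)"
      unfolding S_def two_sided_coefficient[OF a b] by (auto simp: a_def b_def)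
    finally show ?thesis by simp
  qed
  then have "null_spectrum (\<lambda>t. \<phi> t - S t)"
    by (simp add: null_spectrum_def continuous_on_diff cont contS)
  then have "\<phi> t - S t = 0"
    by (rule null_spectrum_imp_zero) (simp add: circle_test_periodic[OF \<phi>] S_def)
  then show ?thesis by (simp add: S_def a_def b_def)
qed

section \<open>Termwise application of distributions\<close>

text \<open>The complex-valued counterpart of \<open>bc_distribution\<close>, satisfied by the two parts of a
  bicomplex distribution.\<close>
definition circle_distribution :: "((real \<Rightarrow> complex) \<Rightarrow> complex) \<Rightarrow> bool" where
  "circle_distribution L \<longleftrightarrow>
     (\<forall>\<phi>\<in>circle_test. \<forall>\<psi>\<in>circle_test. L (\<lambda>t. \<phi> t + \<psi> t) = L \<phi> + L \<psi>) \<and>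
     (\<forall>c. \<forall>\<phi>\<in>circle_test. L (\<lambda>t. c * \<phi> t) = c * L \<phi>) \<and>
     (\<exists>C N. \<forall>\<phi>\<in>circle_test. cmod (L \<phi>) \<le> C * Ck_norm N \<phi>)"

text \<open>Off the index \<open>\<bar>m\<bar>\<close> the frequency is set to \<open>0\<close>, so that it never exceeds the index, as
  required by the lemmas on series of oscillations.\<close>
lemma osc_eq_series:
  "osc m = (\<lambda>t. \<Sum>n. (if n = nat \<bar>m\<bar> then 1 else 0) * osc (if n = nat \<bar>m\<bar> then m else 0) t)"
proof
  fix t
  have "(\<lambda>n. (if n = nat \<bar>m\<bar> then 1 else 0) * osc (if n = nat \<bar>m\<bar> then m else 0) t) =
     (\<lambda>n. if n = nat \<bar>m\<bar> then osc m t else 0)" by auto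
  then show "osc m t = (\<Sum>n. (if n = nat \<bar>m\<bar> then 1 else 0) * osc (if n = nat \<bar>m\<bar> then m else 0) t)"
    using sums_single[of "nat \<bar>m\<bar>" "\<lambda>_. osc m t"] by (simp add: sums_iff)
qed

lemma rapid_single: "rapid (\<lambda>n. if n = k then c else 0)"
  unfolding rapid_def
proof
  fix j
  have "(\<lambda>n. cmod (if n = k then c else 0) * real (Suc n) ^ j) = (\<lambda>n. if n = k then cmod c * real (Suc n) ^ j else 0)"
    by auto
  then show "summable (\<lambda>n. cmod (if n = k then c else 0) * real (Suc n) ^ j)"
    using sums_single[of k "\<lambda>n. cmod c * real (Suc n) ^ j"] by (simp only: sums_iff)
qed

lemma osc_circle_test: "osc m \<in> circle_test"
  by (subst osc_eq_series, rule osc_series_circle_test[OF rapid_single]) auto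

text \<open>Combines the continuity of \<open>L\<close> with the bound of the seminorms of a series by its weighted
  coefficients. The constants depend on \<open>L\<close> alone.\<close>
lemma distribution_bound:
  assumes "circle_distribution L"
  shows "\<exists>C K. \<forall>c m. rapid c \<longrightarrow> (\<forall>n. \<bar>m n\<bar> \<le> int n) \<longrightarrow>
           cmod (L (\<lambda>t. \<Sum>n. c n * osc (m n) t)) \<le> C * (\<Sum>n. cmod (c n) * real (Suc n) ^ K)"
proof -
  obtain C K where CK: "\<And>\<phi>. \<phi> \<in> circle_test \<Longrightarrow> cmod (L \<phi>) \<le> C * Ck_norm K \<phi>"
    using assms unfolding circle_distribution_def by blast
  show ?thesis
  proof (intro exI[of _ "\<bar>C\<bar> * real (Suc K)"] exI[of _ K] allI impI)
    fix c m assume c: "rapid c" and "\<forall>n. \<bar>m n\<bar> \<le> int n"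
    then have m: "\<And>n. \<bar>m n\<bar> \<le> int n" by blast
    let ?S = "\<lambda>t. \<Sum>n. c n * osc (m n) t"
    have "cmod (L ?S) \<le> C * Ck_norm K ?S" by (rule CK[OF osc_series_circle_test[OF c m]])
    also have "\<dots> \<le> \<bar>C\<bar> * Ck_norm K ?S"
      by (intro mult_right_mono Ck_norm_osc_series[OF c m]) auto
    also have "\<dots> \<le> \<bar>C\<bar> * (real (Suc K) * (\<Sum>n. cmod (c n) * real (Suc n) ^ K))"
      by (intro mult_left_mono Ck_norm_osc_series[OF c m]) auto
    finally show "cmod (L ?S) \<le> \<bar>C\<bar> * real (Suc K) * (\<Sum>n. cmod (c n) * real (Suc n) ^ K)"
      by (simp only: mult.assoc)
  qed
qed

lemma distribution_growth:
  assumes "circle_distribution L"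
  obtains C K where "\<And>m n. \<bar>m\<bar> = int n \<Longrightarrow> cmod (L (osc m)) \<le> C * real (Suc n) ^ K"
proof -
  obtain C K where CK: "\<And>c m. rapid c \<Longrightarrow> (\<And>n. \<bar>m n\<bar> \<le> int n) \<Longrightarrow>
           cmod (L (\<lambda>t. \<Sum>n. c n * osc (m n) t)) \<le> C * (\<Sum>n. cmod (c n) * real (Suc n) ^ K)"
    using distribution_bound[OF assms] by blast
  show thesis
  proof (rule that)
    fix m :: int and n :: nat assume "\<bar>m\<bar> = int n"
    then have n: "n = nat \<bar>m\<bar>" by simp
    have "cmod (L (osc m)) \<le> C * (\<Sum>j. cmod (if j = nat \<bar>m\<bar> then 1 else 0) * real (Suc j) ^ K)"
      by (subst osc_eq_series, rule CK[OF rapid_single]) auto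
    also have "(\<lambda>j. cmod (if j = nat \<bar>m\<bar> then 1 else 0) * real (Suc j) ^ K) = (\<lambda>j. if j = n then real (Suc j) ^ K else 0)"
      by (auto simp: n)
    also have "(\<Sum>j. if j = n then real (Suc j) ^ K else 0) = real (Suc n) ^ K"
      using sums_single[of n "\<lambda>j. real (Suc j) ^ K"] by (simp only: sums_iff)
    finally show "cmod (L (osc m)) \<le> C * real (Suc n) ^ K" .
  qed
qed

text \<open>By linearity \<open>L\<close> may be applied term by term to any partial sum. The remaining tail is a
  series of the same kind, and the seminorm that controls \<open>L\<close> on it is bounded by the tail of
  the convergent series of weighted coefficients.\<close>
lemma distribution_series:
  assumes L: "circle_distribution L" and c: "rapid c" and m: "\<And>n. \<bar>m n\<bar> \<le> int n"
  shows "(\<lambda>n. c n * L (osc (m n))) sums L (\<lambda>t. \<Sum>n. c n * osc (m n) t)"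
proof -
  have add: "\<And>\<phi> \<psi>. \<phi> \<in> circle_test \<Longrightarrow> \<psi> \<in> circle_test \<Longrightarrow> L (\<lambda>t. \<phi> t + \<psi> t) = L \<phi> + L \<psi>"
    and cmult: "\<And>c \<phi>. \<phi> \<in> circle_test \<Longrightarrow> L (\<lambda>t. c * \<phi> t) = c * L \<phi>"
    using L by (auto simp: circle_distribution_def)
  define d where "d N n = (if n < N then 0 else c n)" for N n
  have d: "rapid (d N)" for N by (rule rapid_mono[OF c]) (auto simp: d_def)
  define tail where "tail N t = (\<Sum>n. d N n * osc (m n) t)" for N t
  have tail: "tail N \<in> circle_test" for N
    unfolding tail_def by (rule osc_series_circle_test[OF d m])
  have tail_sums: "(\<lambda>n. d N n * osc (m n) t) sums tail N t" for N t
    unfolding tail_def by (rule osc_series_sums[OF rapid_imp_summable_norm[OF d]])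
  have mono_test: "(\<lambda>t. c N * osc (m N) t) \<in> circle_test" for N
  proof -
    have "(\<lambda>t. \<Sum>n. (if n = N then c N else 0) * osc (m n) t) \<in> circle_test"
      by (rule osc_series_circle_test[OF rapid_single m])
    moreover have "(\<Sum>n. (if n = N then c N else 0) * osc (m n) t) = c N * osc (m N) t" for t
      using sums_single[of N "\<lambda>n. c N * osc (m n) t"]
      by (simp add: sums_iff if_distrib[of "\<lambda>x. x * _"] cong: if_cong)
    ultimately show ?thesis by simp
  qed
  have step: "tail N t = c N * osc (m N) t + tail (Suc N) t" for N t
  proof -
    have "(\<lambda>n. (if n = N then c n * osc (m n) t else 0) + d (Suc N) n * osc (m n) t) sums
            (c N * osc (m N) t + tail (Suc N) t)"
      by (rule sums_add[OF sums_single tail_sums])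
    moreover have "(\<lambda>n. (if n = N then c n * osc (m n) t else 0) + d (Suc N) n * osc (m n) t) = (\<lambda>n. d N n * osc (m n) t)"
      by (auto simp: d_def fun_eq_iff)
    ultimately show ?thesis by (intro sums_unique2[OF tail_sums]) simp
  qed
  have split: "L (tail 0) = (\<Sum>n<N. c n * L (osc (m n))) + L (tail N)" for N
  proof (induction N)
    case (Suc N)
    have "L (tail N) = L (\<lambda>t. c N * osc (m N) t) + L (tail (Suc N))"
      unfolding add[OF mono_test tail, symmetric] step[symmetric] ..
    then show ?case using Suc cmult[OF osc_circle_test] by (simp add: add.assoc)
  qed simp
  obtain C K where CK: "\<And>c m. rapid c \<Longrightarrow> (\<And>n. \<bar>m n\<bar> \<le> int n) \<Longrightarrow>
           cmod (L (\<lambda>t. \<Sum>n. c n * osc (m n) t)) \<le> C * (\<Sum>n. cmod (c n) * real (Suc n) ^ K)"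
    using distribution_bound[OF L] by blast
  let ?w = "\<lambda>n. cmod (c n) * real (Suc n) ^ K"
  have "cmod (L (tail N)) \<le> C * (suminf ?w - (\<Sum>n<N. ?w n))" for N
  proof -
    have "(\<lambda>n. ?w n - (if n \<in> {..<N} then ?w n else 0)) sums (suminf ?w - (\<Sum>n<N. ?w n))"
      by (intro sums_diff summable_sums[OF rapidD[OF c]] sums_If_finite_set) auto
    moreover have "(\<lambda>n. ?w n - (if n \<in> {..<N} then ?w n else 0)) = (\<lambda>n. cmod (d N n) * real (Suc n) ^ K)"
      by (auto simp: d_def fun_eq_iff)
    ultimately have "(\<Sum>n. cmod (d N n) * real (Suc n) ^ K) = suminf ?w - (\<Sum>n<N. ?w n)"
      by (simp only: sums_iff)
    then show ?thesis using CK[OF d m, of N] by (simp add: tail_def[abs_def])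
  qed
  moreover have "(\<lambda>N. C * (suminf ?w - (\<Sum>n<N. ?w n))) \<longlonglongrightarrow> C * (suminf ?w - suminf ?w)"
    by (intro tendsto_intros summable_LIMSEQ rapidD[OF c])
  ultimately have "(\<lambda>N. L (tail N)) \<longlonglongrightarrow> 0"
    by (intro Lim_null_comparison[of "\<lambda>N. L (tail N)"] always_eventually) auto
  then have "(\<lambda>N. L (tail 0) - L (tail N)) \<longlonglongrightarrow> L (tail 0) - 0"
    by (intro tendsto_intros)
  moreover have "L (tail 0) - L (tail N) = (\<Sum>n<N. c n * L (osc (m n)))" for N
    using split[of N] by simp
  ultimately have "(\<lambda>n. c n * L (osc (m n))) sums L (tail 0)" by (simp add: sums_def)
  then show ?thesis by (simp add: tail_def[abs_def] d_def)
qed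

section \<open>Harmonic series on the disk\<close>

text \<open>Absolute convergence of the power series with coefficients \<open>a\<close> in the open unit disk.\<close>
definition disk_summable :: "(nat \<Rightarrow> complex) \<Rightarrow> bool" where
  "disk_summable a \<longleftrightarrow> (\<forall>r. 0 \<le> r \<longrightarrow> r < 1 \<longrightarrow> summable (\<lambda>n. cmod (a n) * r ^ n))"

text \<open>The general harmonic function on the disk, as a holomorphic plus an antiholomorphic power
  series.\<close>
definition disk_series :: "(nat \<Rightarrow> complex) \<Rightarrow> (nat \<Rightarrow> complex) \<Rightarrow> complex \<Rightarrow> complex" where
  "disk_series a b z = (\<Sum>n. a n * z ^ n) + (\<Sum>n. b n * cnj z ^ n)"

lemma disk_summableD:
  assumes "disk_summable a" "0 \<le> r" "r < 1"
  shows "summable (\<lambda>n. cmod (a n * of_real r ^ n))"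
  using assms by (simp add: disk_summable_def norm_mult norm_power)

lemma disk_summable_sums:
  assumes "disk_summable a" "cmod z < 1"
  shows "(\<lambda>n. a n * z ^ n) sums (\<Sum>n. a n * z ^ n)"
proof -
  have "summable (\<lambda>n. cmod (a n) * cmod z ^ n)"
    using assms by (simp add: disk_summable_def)
  then show ?thesis
    by (intro summable_sums, intro summable_norm_cancel[of "\<lambda>n. a n * z ^ n"]) (simp add: norm_mult norm_power)
qed

lemma disk_summable_if_growth:
  assumes "\<And>n. cmod (a n) \<le> C * real (Suc n) ^ K"
  shows "disk_summable a"
  unfolding disk_summable_def
proof (intro allI impI)
  fix r :: real assume r: "0 \<le> r" "r < 1"
  have "rapid (\<lambda>n. of_real r ^ n * a n)"
    using r by (intro rapid_mult[OF rapid_geometric assms]) simp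
  from rapid_imp_summable_norm[OF this] show "summable (\<lambda>n. cmod (a n) * r ^ n)"
    using r by (simp add: norm_mult norm_power mult.commute)
qed

lemma holomorphic_on_disk_series:
  assumes "disk_summable a"
  shows "(\<lambda>z. \<Sum>n. a n * z ^ n) holomorphic_on ball 0 1"
  by (rule power_series_holomorphic[where a = a]) (use disk_summable_sums[OF assms] in auto)

lemma holomorphic_imp_disk_series:
  assumes "F holomorphic_on ball 0 1"
  obtains a where "disk_summable a" "\<And>z. z \<in> ball 0 1 \<Longrightarrow> F z = (\<Sum>n. a n * z ^ n)"
proof
  let ?a = "\<lambda>n. (deriv ^^ n) F 0 / fact n"
  have sums: "(\<lambda>n. ?a n * z ^ n) sums F z" if "z \<in> ball 0 1" for z
    using holomorphic_power_series[OF assms that] by simp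
  then show "\<And>z. z \<in> ball 0 1 \<Longrightarrow> F z = (\<Sum>n. ?a n * z ^ n)" by (simp add: sums_iff)
  show "disk_summable ?a" unfolding disk_summable_def
  proof (intro allI impI)
    fix r :: real assume r: "0 \<le> r" "r < 1"
    \<comment> \<open>A point strictly between the circle of radius \<open>r\<close> and the unit circle.\<close>
    have "summable (\<lambda>n. ?a n * of_real ((1 + r) / 2) ^ n)"
      by (rule sums_summable, rule sums) (use r in \<open>simp del: of_real_add of_real_divide\<close>)
    then have "summable (\<lambda>n. norm (?a n * of_real r ^ n))"
      by (rule powser_insidea) (use r in \<open>simp del: of_real_add of_real_divide\<close>)
    then show "summable (\<lambda>n. cmod (?a n) * r ^ n)" using r by (simp add: norm_mult norm_power norm_divide)
  qed
qed

lemma disk_series_polar: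
  "disk_series a b (of_real r * cis \<theta>) =
     (\<Sum>n. (a n * of_real r ^ n) * osc (int n) \<theta>) + (\<Sum>n. (b n * of_real r ^ n) * osc (- int n) \<theta>)"
  by (simp add: disk_series_def osc_def power_mult_distrib Complex.DeMoivre cis_cnj mult.assoc)

lemma continuous_on_disk_series_circle:
  assumes "disk_summable a" "disk_summable b" "0 \<le> r" "r < 1"
  shows "continuous_on S (\<lambda>\<theta>. disk_series a b (of_real r * cis \<theta>))"
  unfolding disk_series_polar
  by (intro continuous_on_add continuous_on_osc_series disk_summableD assms)

lemma integral_disk_series:
  assumes a: "disk_summable a" and b: "disk_summable b" and r: "0 \<le> r" "r < 1"
    and \<psi>: "continuous_on {0..2*pi} \<psi>"
  shows "integral {0..2*pi} (\<lambda>\<theta>. disk_series a b (of_real r * cis \<theta>) * \<psi> \<theta>) =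
     (\<Sum>n. a n * integral {0..2*pi} (\<lambda>t. osc (int n) t * \<psi> t) * of_real r ^ n) +
     (\<Sum>n. b n * integral {0..2*pi} (\<lambda>t. osc (- int n) t * \<psi> t) * of_real r ^ n)"
proof -
  note sa = disk_summableD[OF a r] and sb = disk_summableD[OF b r]
  have "integral {0..2*pi} (\<lambda>\<theta>. disk_series a b (of_real r * cis \<theta>) * \<psi> \<theta>) =
     integral {0..2*pi} (\<lambda>\<theta>. (\<Sum>n. (a n * of_real r ^ n) * osc (int n) \<theta>) * \<psi> \<theta>) +
     integral {0..2*pi} (\<lambda>\<theta>. (\<Sum>n. (b n * of_real r ^ n) * osc (- int n) \<theta>) * \<psi> \<theta>)"
    unfolding disk_series_polar distrib_right
    by (intro integral_add integrable_continuous_real continuous_on_mult continuous_on_osc_series sa sb \<psi>)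
  also have "integral {0..2*pi} (\<lambda>\<theta>. (\<Sum>n. (a n * of_real r ^ n) * osc (int n) \<theta>) * \<psi> \<theta>) =
      (\<Sum>n. (a n * of_real r ^ n) * integral {0..2*pi} (\<lambda>t. osc (int n) t * \<psi> t))"
    using integral_osc_series[OF sa \<psi>] by (rule sums_unique)
  also have "integral {0..2*pi} (\<lambda>\<theta>. (\<Sum>n. (b n * of_real r ^ n) * osc (- int n) \<theta>) * \<psi> \<theta>) =
      (\<Sum>n. (b n * of_real r ^ n) * integral {0..2*pi} (\<lambda>t. osc (- int n) t * \<psi> t))"
    using integral_osc_series[OF sb \<psi>] by (rule sums_unique)
  finally show ?thesis by (simp add: mult_ac)
qed

text \<open>Absolute convergence makes the series uniformly convergent on \<open>{0..1}\<close>, so the sum is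
  continuous up to the endpoint.\<close>
lemma abel_limit:
  fixes c :: "nat \<Rightarrow> complex"
  assumes "summable (\<lambda>n. cmod (c n))"
  shows "((\<lambda>r. \<Sum>n. c n * of_real r ^ n) \<longlongrightarrow> (\<Sum>n. c n)) (at_left 1)"
proof -
  have "uniform_limit {0..1} (\<lambda>N r. \<Sum>n<N. c n * of_real r ^ n) (\<lambda>r. \<Sum>n. c n * of_real r ^ n) sequentially"
    by (rule Weierstrass_m_test[OF _ assms])
       (auto simp: norm_mult norm_power intro!: mult_left_le power_le_one)
  then have "continuous_on {0..1::real} (\<lambda>r. \<Sum>n. c n * of_real r ^ n)"
    by (rule uniform_limit_theorem[rotated]) (auto intro!: always_eventually continuous_intros)
  then have "((\<lambda>r. \<Sum>n. c n * of_real r ^ n) \<longlongrightarrow> (\<Sum>n. c n * of_real 1 ^ n)) (at 1 within {0..1})"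
    unfolding continuous_on by (auto dest: bspec[of _ _ 1])
  then show ?thesis by (simp add: at_within_Icc_at_left)
qed

text \<open>The integral against \<open>osc (- m)\<close> is a constant multiple of \<open>r ^ \<bar>m\<bar>\<close>. It tends to zero
  only if the constant is zero, which kills the coefficient of frequency \<open>m\<close>, and for \<open>m = 0\<close> the
  sum of the two constant terms.\<close>
lemma disk_series_zero:
  assumes a: "disk_summable a" and b: "disk_summable b"
    and lim: "\<And>m. ((\<lambda>r. integral {0..2*pi} (\<lambda>\<theta>. disk_series a b (of_real r * cis \<theta>) * osc m \<theta>)) \<longlongrightarrow> 0) (at_left 1)"
  shows "disk_series a b z = 0"
proof -
  have coeff: "(if m \<ge> 0 then a (nat m) else 0) + (if m \<le> 0 then b (nat (- m)) else 0) = 0" (is "?c = 0") for m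
  proof -
    have "\<forall>\<^sub>F r in at_left 1. integral {0..2*pi} (\<lambda>\<theta>. disk_series a b (of_real r * cis \<theta>) * osc (- m) \<theta>)
        = 2 * pi * ?c * of_real r ^ nat \<bar>m\<bar>"
      using eventually_at_left_real[of 0 1, OF zero_less_one]
    proof eventually_elim
      case (elim r)
      then have r: "0 \<le> r" "r < 1" by auto
      show ?case unfolding disk_series_polar
          two_sided_coefficient[OF disk_summableD[OF a r] disk_summableD[OF b r]]
        by (auto simp: algebra_simps)
    qed
    then have "((\<lambda>r. 2 * pi * ?c * of_real r ^ nat \<bar>m\<bar>) \<longlongrightarrow> 0) (at_left 1)"
      using lim[of "- m"] tendsto_cong by fastforce
    moreover have "((\<lambda>r. 2 * pi * ?c * of_real r ^ nat \<bar>m\<bar>) \<longlongrightarrow> 2 * pi * ?c * of_real 1 ^ nat \<bar>m\<bar>) (at_left 1)"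
      by (intro tendsto_intros)
    ultimately have "2 * pi * ?c * of_real 1 ^ nat \<bar>m\<bar> = 0"
      using tendsto_unique[OF trivial_limit_at_left_real] by blast
    then show ?thesis by simp
  qed
  have "a n = 0" "b n = 0" if "n > 0" for n
    using coeff[of "int n"] coeff[of "- int n"] that by auto
  then have "(\<lambda>n. a n * z ^ n) = (\<lambda>n. if n = 0 then a n else 0)" "(\<lambda>n. b n * cnj z ^ n) = (\<lambda>n. if n = 0 then b n else 0)"
    by auto
  then have "disk_series a b z = a 0 + b 0"
    using sums_single[of 0 a] sums_single[of 0 b] by (simp add: disk_series_def sums_iff)
  also have "\<dots> = 0" using coeff[of 0] by simp
  finally show ?thesis .
qed

lemma disk_series_unique:
  assumes a: "disk_summable a" and b: "disk_summable b"
    and c: "disk_summable c" and d: "disk_summable d"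
    and lim: "\<And>m. ((\<lambda>r. integral {0..2*pi} (\<lambda>\<theta>. disk_series a b (of_real r * cis \<theta>) * osc m \<theta>)) \<longlongrightarrow> l m) (at_left 1)"
      "\<And>m. ((\<lambda>r. integral {0..2*pi} (\<lambda>\<theta>. disk_series c d (of_real r * cis \<theta>) * osc m \<theta>)) \<longlongrightarrow> l m) (at_left 1)"
    and z: "z \<in> ball 0 1"
  shows "disk_series a b z = disk_series c d z"
proof -
  let ?a = "\<lambda>n. a n - c n" and ?b = "\<lambda>n. b n - d n"
  have diff: "disk_summable (\<lambda>n. x n - y n)" if "disk_summable x" "disk_summable y" for x y
    unfolding disk_summable_def
  proof (intro allI impI)
    fix r :: real assume r: "0 \<le> r" "r < 1"
    show "summable (\<lambda>n. cmod (x n - y n) * r ^ n)"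
    proof (rule summable_comparison_test')
      show "summable (\<lambda>n. cmod (x n) * r ^ n + cmod (y n) * r ^ n)"
        using that r by (intro summable_add) (auto simp: disk_summable_def)
      show "norm (cmod (x n - y n) * r ^ n) \<le> cmod (x n) * r ^ n + cmod (y n) * r ^ n" for n
        using r norm_triangle_ineq4[of "x n" "y n"]
        by (simp add: abs_mult distrib_right[symmetric] mult_right_mono)
    qed
  qed
  have eq: "disk_series ?a ?b w = disk_series a b w - disk_series c d w" if "cmod w < 1" for w
  proof -
    have "cmod (cnj w) < 1" using that by simp
    note s = disk_summable_sums[OF _ that] and s' = disk_summable_sums[OF _ this]
    show ?thesis
      using sums_diff[OF s[OF a] s[OF c]] sums_diff[OF s'[OF b] s'[OF d]]
      by (simp add: disk_series_def left_diff_distrib sums_iff)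
  qed
  have "((\<lambda>r. integral {0..2*pi} (\<lambda>\<theta>. disk_series ?a ?b (of_real r * cis \<theta>) * osc m \<theta>)) \<longlongrightarrow> 0) (at_left 1)" for m
  proof -
    have "\<forall>\<^sub>F r in at_left 1. integral {0..2*pi} (\<lambda>\<theta>. disk_series a b (of_real r * cis \<theta>) * osc m \<theta>)
        - integral {0..2*pi} (\<lambda>\<theta>. disk_series c d (of_real r * cis \<theta>) * osc m \<theta>)
        = integral {0..2*pi} (\<lambda>\<theta>. disk_series ?a ?b (of_real r * cis \<theta>) * osc m \<theta>)"
      using eventually_at_left_real[of 0 1, OF zero_less_one]
    proof eventually_elim
      case (elim r)
      then have r: "0 \<le> r" "r < 1" by auto
      then have e: "disk_series ?a ?b (of_real r * cis \<theta>) = disk_series a b (of_real r * cis \<theta>) - disk_series c d (of_real r * cis \<theta>)" for \<theta>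
        by (intro eq) (simp add: norm_mult)
      show ?case unfolding e left_diff_distrib
        by (intro integral_diff[symmetric] integrable_continuous_real continuous_on_mult continuous_on_osc
            continuous_on_disk_series_circle a b c d r)
    qed
    moreover have "((\<lambda>r. integral {0..2*pi} (\<lambda>\<theta>. disk_series a b (of_real r * cis \<theta>) * osc m \<theta>)
        - integral {0..2*pi} (\<lambda>\<theta>. disk_series c d (of_real r * cis \<theta>) * osc m \<theta>)) \<longlongrightarrow> l m - l m) (at_left 1)"
      by (intro tendsto_diff lim)
    ultimately show ?thesis using Lim_transform_eventually by fastforce
  qed
  then have "disk_series ?a ?b z = 0" by (intro disk_series_zero diff a b c d)
  then show ?thesis using eq[of z] z by simp
qed

section \<open>The Poisson extension of a distribution\<close>

text \<open>Fourier coefficients of the distribution, for frequencies \<open>n\<close> and \<open>- n\<close> respectively. The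
  constant term is counted once, in \<open>pos_coeff\<close>.\<close>
definition pos_coeff :: "((real \<Rightarrow> complex) \<Rightarrow> complex) \<Rightarrow> nat \<Rightarrow> complex" where
  "pos_coeff L n = L (osc (- int n)) / (2*pi)"

definition neg_coeff :: "((real \<Rightarrow> complex) \<Rightarrow> complex) \<Rightarrow> nat \<Rightarrow> complex" where
  "neg_coeff L n = (if n = 0 then 0 else L (osc (int n)) / (2*pi))"

abbreviation poisson_extension :: "((real \<Rightarrow> complex) \<Rightarrow> complex) \<Rightarrow> complex \<Rightarrow> complex" where
  "poisson_extension L \<equiv> disk_series (pos_coeff L) (neg_coeff L)"

lemma coeff_growth:
  assumes "circle_distribution L"
  obtains C K where "\<And>n. cmod (pos_coeff L n) \<le> C * real (Suc n) ^ K" "\<And>n. cmod (neg_coeff L n) \<le> C * real (Suc n) ^ K"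
proof -
  obtain C K where CK: "\<And>m n. \<bar>m\<bar> = int n \<Longrightarrow> cmod (L (osc m)) \<le> C * real (Suc n) ^ K"
    by (rule distribution_growth[OF assms]) blast
  have "0 \<le> C"
    using CK[of 0 0] norm_ge_zero[of "L (osc 0)"] by (simp del: norm_ge_zero)
  have *: "cmod (L (osc m)) / (2*pi) \<le> C / (2*pi) * real (Suc n) ^ K" if "\<bar>m\<bar> = int n" for m n
    using divide_right_mono[OF CK[OF that], of "2*pi"] by simp
  show thesis
  proof (rule that)
    show "cmod (pos_coeff L n) \<le> C / (2*pi) * real (Suc n) ^ K" for n
      using *[of "- int n" n] by (simp add: pos_coeff_def norm_divide norm_mult)
    show "cmod (neg_coeff L n) \<le> C / (2*pi) * real (Suc n) ^ K" for n
      using *[of "int n" n] \<open>0 \<le> C\<close> by (simp add: neg_coeff_def norm_divide norm_mult)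
  qed
qed

lemma disk_summable_coeff:
  assumes "circle_distribution L"
  shows "disk_summable (pos_coeff L)" "disk_summable (neg_coeff L)"
  by (rule coeff_growth[OF assms]; erule disk_summable_if_growth)+

text \<open>Parseval's formula for the pairing of a distribution with a smooth function.\<close>
lemma distribution_two_sided:
  assumes L: "circle_distribution L" and a: "rapid a" and b: "rapid b" and b0: "b 0 = 0"
  shows "L (\<lambda>t. (\<Sum>n. b n * osc (int n) t) + (\<Sum>n. a n * osc (- int n) t)) =
     2 * pi * ((\<Sum>n. pos_coeff L n * a n) + (\<Sum>n. neg_coeff L n * b n))"
proof -
  have A: "(\<lambda>n. pos_coeff L n * a n) sums (L (\<lambda>t. \<Sum>n. a n * osc (- int n) t) / (2*pi))"
    using sums_divide[OF distribution_series[OF L a, of "\<lambda>n. - int n"], of "2*pi"]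
    by (simp add: pos_coeff_def mult.commute)
  have "(\<lambda>n. neg_coeff L n * b n) = (\<lambda>n. b n * L (osc (int n)) / (2*pi))"
    by (auto simp: neg_coeff_def b0)
  then have B: "(\<lambda>n. neg_coeff L n * b n) sums (L (\<lambda>t. \<Sum>n. b n * osc (int n) t) / (2*pi))"
    using sums_divide[OF distribution_series[OF L b, of int], of "2*pi"] by simp
  have "L (\<lambda>t. (\<Sum>n. b n * osc (int n) t) + (\<Sum>n. a n * osc (- int n) t)) =
     L (\<lambda>t. \<Sum>n. b n * osc (int n) t) + L (\<lambda>t. \<Sum>n. a n * osc (- int n) t)"
    using L osc_series_circle_test[OF a, of "\<lambda>n. - int n"] osc_series_circle_test[OF b, of int]
    unfolding circle_distribution_def by simp
  then show ?thesis using A B by (simp add: sums_iff field_simps)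
qed

text \<open>With \<open>w = r exp (i (\<theta> - t))\<close> both sums are geometric series, and
  \<open>1 / (1 - w) + 1 / (1 - cnj w) - 1 = (1 - \<bar>w\<bar>\<^sup>2) / \<bar>1 - w\<bar>\<^sup>2\<close>.\<close>
lemma poisson_kernel_series:
  assumes "0 \<le> r" "r < 1"
  shows "complex_of_real (poisson_kernel r (\<theta> - t)) =
      (\<Sum>n. (if n = 0 then 0 else (of_real r * cis (- \<theta>)) ^ n) * osc (int n) t)
      + (\<Sum>n. (of_real r * cis \<theta>) ^ n * osc (- int n) t)"
proof -
  define w where "w = of_real r * cis (\<theta> - t)"
  have w: "cmod w < 1" using assms by (simp add: w_def norm_mult)
  have "(of_real r * cis \<theta>) ^ n * osc (- int n) t = w ^ n" for n
    by (simp add: w_def osc_def power_mult_distrib Complex.DeMoivre cis_mult algebra_simps)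
  then have 1: "(\<Sum>n. (of_real r * cis \<theta>) ^ n * osc (- int n) t) = 1 / (1 - w)"
    using suminf_geometric[OF w] by simp
  have "(of_real r * cis (- \<theta>)) ^ n * osc (int n) t = cnj w ^ n" for n
    by (simp add: w_def osc_def power_mult_distrib Complex.DeMoivre cis_mult cis_cnj algebra_simps)
  then have "(\<lambda>n. (if n = 0 then 0 else (of_real r * cis (- \<theta>)) ^ n) * osc (int n) t) = (\<lambda>n. cnj w ^ n - (if n = 0 then 1 else 0))"
    by (auto simp: fun_eq_iff)
  moreover have "(\<lambda>n. cnj w ^ n - (if n = 0 then 1 else 0)) sums (1 / (1 - cnj w) - 1)"
    using w by (intro sums_diff geometric_sums sums_single) auto
  ultimately have 2: "(\<Sum>n. (if n = 0 then 0 else (of_real r * cis (- \<theta>)) ^ n) * osc (int n) t) = 1 / (1 - cnj w) - 1"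
    by (simp add: sums_iff)
  have ne: "1 - w \<noteq> 0" "1 - cnj w \<noteq> 0" using w by auto
  have ww: "w * cnj w = of_real (r\<^sup>2)"
    by (simp add: w_def cis_cnj cis_mult power2_eq_square algebra_simps)
  have wr: "w + cnj w = of_real (2 * r * cos (\<theta> - t))"
    by (simp add: w_def complex_eq_iff)
  have den: "(1 - w) * (1 - cnj w) = of_real (1 - 2 * r * cos (\<theta> - t) + r\<^sup>2)"
  proof -
    have "(1 - w) * (1 - cnj w) = 1 - (w + cnj w) + w * cnj w" by (simp add: algebra_simps)
    then show ?thesis unfolding ww wr by simp
  qed
  have "1 / (1 - cnj w) - 1 + 1 / (1 - w) = (1 - w * cnj w) / ((1 - w) * (1 - cnj w))"
    using ne by (simp add: divide_simps) (simp add: algebra_simps)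
  also have "\<dots> = complex_of_real (poisson_kernel r (\<theta> - t))"
    unfolding den ww poisson_kernel_def by simp
  finally show ?thesis unfolding 1 2 by simp
qed

lemma poisson_extension_eq:
  assumes L: "circle_distribution L" and r: "0 \<le> r" "r < 1"
  shows "L (\<lambda>t. complex_of_real (poisson_kernel r (\<theta> - t))) = 2 * pi * poisson_extension L (of_real r * cis \<theta>)"
proof -
  have geo: "rapid (\<lambda>n. (of_real r * cis \<alpha>) ^ n)" for \<alpha>
    using r by (intro rapid_geometric) (simp add: norm_mult)
  have "rapid (\<lambda>n. if n = 0 then 0 else (of_real r * cis (- \<theta>)) ^ n)"
    by (rule rapid_mono[OF geo[of "- \<theta>"]]) simp
  note * = distribution_two_sided[OF L geo[of \<theta>] this]
  have "(\<lambda>n. neg_coeff L n * (if n = 0 then 0 else (of_real r * cis (- \<theta>)) ^ n)) =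
     (\<lambda>n. neg_coeff L n * cnj (of_real r * cis \<theta>) ^ n)"
    by (auto simp: neg_coeff_def cis_cnj)
  with * show ?thesis unfolding poisson_kernel_series[OF r] by (simp only: disk_series_def) simp
qed

lemma poisson_extension_boundary:
  assumes L: "circle_distribution L" and \<gamma>: "\<gamma> \<in> circle_test"
  shows "((\<lambda>r. integral {0..2*pi} (\<lambda>\<theta>. poisson_extension L (of_real r * cis \<theta>) * \<gamma> \<theta>)) \<longlongrightarrow> L \<gamma>) (at_left 1)"
proof -
  define b where "b n = (if n = 0 then 0 else fourier_coeff \<gamma> (int n))" for n
  define a where "a n = fourier_coeff \<gamma> (- int n)" for n
  have a: "rapid a" unfolding a_def by (rule rapid_fourier_coeff[OF \<gamma>]) simp
  have b: "rapid b" by (rule rapid_mono[OF rapid_fourier_coeff[OF \<gamma>, of int]]) (auto simp: b_def)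
  obtain C K where CK: "\<And>n. cmod (pos_coeff L n) \<le> C * real (Suc n) ^ K" "\<And>n. cmod (neg_coeff L n) \<le> C * real (Suc n) ^ K"
    by (rule coeff_growth[OF L]) blast
  have sa: "summable (\<lambda>n. cmod (2*pi * (pos_coeff L n * a n)))" 
    using summable_mult[OF rapid_imp_summable_norm[OF rapid_mult[OF a CK(1)]], of "2*pi"] by (simp add: norm_mult mult_ac)
  have sb: "summable (\<lambda>n. cmod (2*pi * (neg_coeff L n * b n)))" 
    using summable_mult[OF rapid_imp_summable_norm[OF rapid_mult[OF b CK(2)]], of "2*pi"] by (simp add: norm_mult mult_ac)
  have ev: "\<forall>\<^sub>F r in at_left 1. integral {0..2*pi} (\<lambda>\<theta>. poisson_extension L (of_real r * cis \<theta>) * \<gamma> \<theta>) =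
      (\<Sum>n. 2*pi * (pos_coeff L n * a n) * of_real r ^ n) + (\<Sum>n. 2*pi * (neg_coeff L n * b n) * of_real r ^ n)"
    using eventually_at_left_real[of 0 1, OF zero_less_one]
  proof eventually_elim
    case (elim r)
    then have r: "0 \<le> r" "r < 1" by auto
    have "pos_coeff L n * integral {0..2*pi} (\<lambda>t. osc (int n) t * \<gamma> t) = 2*pi * (pos_coeff L n * a n)" for n
      by (simp add: a_def fourier_coeff_def)
    moreover have "neg_coeff L n * integral {0..2*pi} (\<lambda>t. osc (- int n) t * \<gamma> t) = 2*pi * (neg_coeff L n * b n)" for n
      by (simp add: b_def fourier_coeff_def neg_coeff_def)
    ultimately show ?case
      using integral_disk_series[OF disk_summable_coeff[OF L] r circle_test_continuous[OF \<gamma>]] by (simp only:)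
  qed
  have "((\<lambda>r. (\<Sum>n. 2*pi * (pos_coeff L n * a n) * of_real r ^ n) + (\<Sum>n. 2*pi * (neg_coeff L n * b n) * of_real r ^ n))
      \<longlongrightarrow> (\<Sum>n. 2*pi * (pos_coeff L n * a n)) + (\<Sum>n. 2*pi * (neg_coeff L n * b n))) (at_left 1)"
    by (rule tendsto_add[OF abel_limit[OF sa] abel_limit[OF sb]])
  moreover have "(\<Sum>n. 2*pi * (pos_coeff L n * a n)) = 2*pi * (\<Sum>n. pos_coeff L n * a n)"
    using sa by (intro suminf_mult, intro summable_norm_cancel[of "\<lambda>n. pos_coeff L n * a n"]) (simp add: norm_mult)
  moreover have "(\<Sum>n. 2*pi * (neg_coeff L n * b n)) = 2*pi * (\<Sum>n. neg_coeff L n * b n)"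
    using sb by (intro suminf_mult, intro summable_norm_cancel[of "\<lambda>n. neg_coeff L n * b n"]) (simp add: norm_mult)
  moreover have "\<gamma> = (\<lambda>t. (\<Sum>n. b n * osc (int n) t) + (\<Sum>n. a n * osc (- int n) t))"
    unfolding a_def b_def by (rule ext, rule fourier_inversion[OF \<gamma>])
  then have "L \<gamma> = 2 * pi * ((\<Sum>n. pos_coeff L n * a n) + (\<Sum>n. neg_coeff L n * b n))"
    using distribution_two_sided[OF L a b] by (simp add: b_def)
  ultimately show ?thesis
    using tendsto_cong[OF ev] by (simp add: distrib_left)
qed

section \<open>Harmonic functions as harmonic series\<close>

lemma real_linear_complex_eq:
  assumes "bounded_linear (D :: complex \<Rightarrow> complex)"
  shows "D h = Re h *\<^sub>R D 1 + Im h *\<^sub>R D \<i>"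
proof -
  interpret bounded_linear D by fact
  have "h = Re h *\<^sub>R 1 + Im h *\<^sub>R \<i>" by (simp add: complex_eq_iff)
  then have "D h = D (Re h *\<^sub>R 1 + Im h *\<^sub>R \<i>)" by simp
  then show ?thesis by (simp only: add scale)
qed

lemma cauchy_riemann_imp_field_derivative:
  assumes D: "(f has_derivative D) (at z)" and cr: "D \<i> = \<i> * D 1"
  shows "(f has_field_derivative D 1) (at z)"
proof -
  have "D h = D 1 * h" for h
    using real_linear_complex_eq[OF has_derivative_bounded_linear[OF D], of h] cr
    by (simp add: complex_eq_iff algebra_simps)
  then have "D = (*) (D 1)" by (rule ext)
  then show ?thesis using D by (simp add: has_field_derivative_def)
qed

text \<open>The hypotheses are phrased with explicit derivatives: \<open>u'\<close> is the real derivative of \<open>u\<close>,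
  \<open>u' z 1 - \<i> * u' z \<i>\<close> is twice \<open>\<partial>u/\<partial>z\<close>, and the last hypothesis is its
  Cauchy--Riemann equation. If \<open>F\<close> is a primitive of \<open>\<partial>u/\<partial>z\<close>, then
  \<open>\<partial>(u - F)/\<partial>z = 0\<close>, which says that \<open>u - F\<close> becomes holomorphic after composition
  with conjugation.\<close>
lemma harmonic_decomposition:
  assumes u: "\<And>z. z \<in> ball 0 1 \<Longrightarrow> (u has_derivative u' z) (at z)"
    and w: "\<And>z. z \<in> ball 0 1 \<Longrightarrow> ((\<lambda>z. u' z 1 - \<i> * u' z \<i>) has_derivative w' z) (at z)"
    and harm: "\<And>z. z \<in> ball 0 1 \<Longrightarrow> w' z 1 + \<i> * w' z \<i> = 0"
  obtains a b where "disk_summable a" "disk_summable b" "\<And>z. z \<in> ball 0 1 \<Longrightarrow> u z = disk_series a b z"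
proof -
  define p where "p z = (u' z 1 - \<i> * u' z \<i>) / 2" for z
  have "(p has_field_derivative w' z 1 / 2) (at z)" if z: "z \<in> ball 0 1" for z
  proof -
    have "w' z \<i> = \<i> * w' z 1" using harm[OF z] by (simp add: complex_eq_iff add_eq_0_iff)
    then show ?thesis unfolding p_def
      by (intro DERIV_cdivide cauchy_riemann_imp_field_derivative[OF w[OF z]])
  qed
  then have "p holomorphic_on ball 0 1"
    by (intro holomorphic_onI) (meson field_differentiable_at_within field_differentiable_def)
  then obtain F where F: "\<And>z. z \<in> ball 0 1 \<Longrightarrow> (F has_field_derivative p z) (at z)"
    using holomorphic_convex_primitive'[OF convex_ball open_ball] by (metis at_within_open open_ball)
  define G where "G z = u (cnj z) - F (cnj z)" for z
  have "\<exists>G'. (G has_field_derivative G') (at z)" if "z \<in> ball 0 1" for z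
  proof -
    have z: "cnj z \<in> ball 0 1" using that by simp
    have "((\<lambda>z. u z - F z) has_derivative (\<lambda>h. u' (cnj z) h - p (cnj z) * h)) (at (cnj z))"
      using has_derivative_diff[OF u[OF z] F[OF z, unfolded has_field_derivative_def]] .
    from has_derivative_compose[OF has_derivative_cnj[OF has_derivative_ident] this]
    have D: "(G has_derivative (\<lambda>h. u' (cnj z) (cnj h) - p (cnj z) * cnj h)) (at z)"
      by (simp add: G_def[abs_def])
    have "u' (cnj z) (- \<i>) = - u' (cnj z) \<i>"
      by (rule linear_neg[OF has_derivative_linear[OF u[OF z]]])
    then have "u' (cnj z) (cnj \<i>) - p (cnj z) * cnj \<i> = \<i> * (u' (cnj z) (cnj 1) - p (cnj z) * cnj 1)"
      by (simp add: p_def field_simps)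
    from cauchy_riemann_imp_field_derivative[OF D this] show ?thesis ..
  qed
  then have "G holomorphic_on ball 0 1"
    by (intro holomorphic_onI) (meson field_differentiable_at_within field_differentiable_def)
  then obtain b where b: "disk_summable b" "\<And>z. z \<in> ball 0 1 \<Longrightarrow> G z = (\<Sum>n. b n * z ^ n)"
    using holomorphic_imp_disk_series by blast
  have "F holomorphic_on ball 0 1"
    using F by (intro holomorphic_onI) (meson field_differentiable_at_within field_differentiable_def)
  then obtain a where a: "disk_summable a" "\<And>z. z \<in> ball 0 1 \<Longrightarrow> F z = (\<Sum>n. a n * z ^ n)"
    using holomorphic_imp_disk_series by blast
  show thesis
  proof (rule that[OF a(1) b(1)])
    fix z :: complex assume z: "z \<in> ball 0 1"
    then have "u z = F z + G (cnj z)" by (simp add: G_def)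
    then show "u z = disk_series a b z" using a(2)[OF z] b(2)[of "cnj z"] z by (simp add: disk_series_def)
  qed
qed

section \<open>Idempotent components of bicomplex functions\<close>

definition of_parts :: "complex \<Rightarrow> complex \<Rightarrow> bicomplex" where
  "of_parts a b = p_plus *\<^sub>B bc a + p_minus *\<^sub>B bc b"

lemma of_parts_eq: "of_parts a b = ((a + b) / 2, \<i> * (a - b) / 2)"
proof -
  have "((a + b) / 2, \<i> * (a - b) / 2) = of_parts a b"
    unfolding of_parts_def idempotent_representation_iff by (simp add: field_simps)
  then show ?thesis ..
qed

lemma parts_of_parts [simp]:
  "plus_part (of_parts a b) = a" "minus_part (of_parts a b) = b"
  by (simp_all add: of_parts_eq plus_part_eq minus_part_eq field_simps)

lemma of_parts_parts: "of_parts (plus_part z) (minus_part z) = z"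
  unfolding of_parts_def by (rule idempotent_representation[symmetric])

lemma bicomplex_eq_iff_parts: "z = w \<longleftrightarrow> plus_part z = plus_part w \<and> minus_part z = minus_part w"
  by (metis of_parts_parts)

lemma parts_simps [simp]:
  "plus_part (z *\<^sub>B w) = plus_part z * plus_part w" "minus_part (z *\<^sub>B w) = minus_part z * minus_part w"
  "plus_part (z + w) = plus_part z + plus_part w" "minus_part (z + w) = minus_part z + minus_part w"
  "plus_part (z - w) = plus_part z - plus_part w" "minus_part (z - w) = minus_part z - minus_part w"
  "plus_part (bc c) = c" "minus_part (bc c) = c" "plus_part 0 = 0" "minus_part 0 = 0"
  "plus_part p_plus = 1" "minus_part p_plus = 0" "plus_part p_minus = 0" "minus_part p_minus = 1"
  by (simp_all add: plus_part_eq minus_part_eq bc_mult_def bc_def bc_j_def p_plus_def p_minus_def algebra_simps)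

lemma bounded_linear_parts: "bounded_linear plus_part" "bounded_linear minus_part"
  unfolding plus_part_eq[abs_def] minus_part_eq[abs_def]
  by (intro bounded_linear_intros bounded_linear_sub bounded_linear_add
      bounded_linear_compose[OF bounded_linear_mult_right bounded_linear_snd] bounded_linear_fst)+

lemma norm_parts_le: "cmod (plus_part z) \<le> 2 * norm z" "cmod (minus_part z) \<le> 2 * norm z"
  using norm_triangle_ineq4[of "fst z" "\<i> * snd z"] norm_triangle_ineq[of "fst z" "\<i> * snd z"]
    norm_fst_le[of "fst z" "snd z"] norm_snd_le[of "snd z" "fst z"]
  by (simp_all add: plus_part_eq minus_part_eq norm_mult)

lemma tendsto_of_parts:
  "(f \<longlongrightarrow> a) F \<Longrightarrow> (g \<longlongrightarrow> b) F \<Longrightarrow> ((\<lambda>x. of_parts (f x) (g x)) \<longlongrightarrow> of_parts a b) F"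
  unfolding of_parts_eq by (intro tendsto_intros) auto

lemma continuous_on_of_parts:
  "continuous_on S f \<Longrightarrow> continuous_on S g \<Longrightarrow> continuous_on S (\<lambda>x. of_parts (f x) (g x))"
  unfolding of_parts_eq by (intro continuous_intros) auto

lemma has_derivative_of_parts:
  assumes "(f has_derivative f') (at x within S)" "(g has_derivative g') (at x within S)"
  shows "((\<lambda>x. of_parts (f x) (g x)) has_derivative (\<lambda>h. of_parts (f' h) (g' h))) (at x within S)"
  unfolding of_parts_eq
  by (intro has_derivative_Pair bounded_linear.has_derivative[OF bounded_linear_divide]
      has_derivative_mult_right has_derivative_add has_derivative_diff assms)

lemma circle_distribution_parts:
  assumes g: "bc_distribution g"
  shows "circle_distribution (\<lambda>\<phi>. plus_part (g \<phi>))" "circle_distribution (\<lambda>\<phi>. minus_part (g \<phi>))"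
proof -
  obtain C N where CN: "\<And>\<phi>. \<phi> \<in> circle_test \<Longrightarrow> norm (g \<phi>) \<le> C * Ck_norm N \<phi>"
    using g unfolding bc_distribution_def by blast
  have "cmod (plus_part (g \<phi>)) \<le> 2 * C * Ck_norm N \<phi>" "cmod (minus_part (g \<phi>)) \<le> 2 * C * Ck_norm N \<phi>"
    if "\<phi> \<in> circle_test" for \<phi>
    using CN[OF that] norm_parts_le[of "g \<phi>"] by linarith+
  with g show "circle_distribution (\<lambda>\<phi>. plus_part (g \<phi>))" "circle_distribution (\<lambda>\<phi>. minus_part (g \<phi>))"
    unfolding bc_distribution_def circle_distribution_def by (simp_all, blast+)
qed

lemma bounded_linear_of_parts:
  "bounded_linear (\<lambda>c. of_parts c 0)" "bounded_linear (\<lambda>c. of_parts 0 c)"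
  unfolding of_parts_eq
  by (simp_all add: bounded_linear_Pair bounded_linear_divide bounded_linear_mult_right
      bounded_linear_compose[OF bounded_linear_divide bounded_linear_mult_right] bounded_linear_minus)

lemma C2_on_add:
  assumes "C2_on S f" "C2_on S g"
  shows "C2_on S (\<lambda>z. f z + g z)"
proof -
  obtain f' f'' g' g'' where
    "\<And>z. z \<in> S \<Longrightarrow> (f has_derivative blinfun_apply (f' z)) (at z)"
    "\<And>z. z \<in> S \<Longrightarrow> (f' has_derivative blinfun_apply (f'' z)) (at z)" "continuous_on S f''"
    "\<And>z. z \<in> S \<Longrightarrow> (g has_derivative blinfun_apply (g' z)) (at z)"
    "\<And>z. z \<in> S \<Longrightarrow> (g' has_derivative blinfun_apply (g'' z)) (at z)" "continuous_on S g''"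
    using assms unfolding C2_on_def by blast
  then show ?thesis unfolding C2_on_def
    by (intro exI[of _ "\<lambda>z. f' z + g' z"] exI[of _ "\<lambda>z. f'' z + g'' z"])
       (auto simp: plus_blinfun.rep_eq intro!: has_derivative_add continuous_on_add)
qed

text \<open>A real-linear \<open>A\<close> covers the embeddings of the two idempotent components and, after
  composition with conjugation, also the antiholomorphic terms of a solution.\<close>
lemma C2_on_linear_holomorphic:
  assumes A: "bounded_linear (A :: complex \<Rightarrow> bicomplex)" and H: "H holomorphic_on S" and S: "open S"
  shows "C2_on S (\<lambda>z. A (H z))"
proof -
  define T :: "complex \<Rightarrow> complex \<Rightarrow>\<^sub>L bicomplex" where "T c = Blinfun A o\<^sub>L blinfun_mult_right c" for c
  have T_apply: "blinfun_apply (T c) h = A (c * h)" for c h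
    using A by (simp add: T_def bounded_linear_Blinfun_apply)
  have T: "bounded_linear T"
    unfolding T_def[abs_def]
    by (intro bounded_linear_compose[OF bounded_bilinear.bounded_linear_right[OF bounded_bilinear_blinfun_compose]]
        bounded_linear_blinfun_mult_right)
  define U where "U c = Blinfun T o\<^sub>L blinfun_mult_right c" for c
  have U_apply: "blinfun_apply (U c) h = T (c * h)" for c h
    using T by (simp add: U_def bounded_linear_Blinfun_apply)
  have H': "deriv H holomorphic_on S" by (rule holomorphic_deriv[OF H S])
  have H'': "continuous_on S (deriv (deriv H))"
    by (rule holomorphic_on_imp_continuous_on[OF holomorphic_deriv[OF H' S]])
  have d1: "(H has_derivative (\<lambda>h. deriv H z * h)) (at z)" if "z \<in> S" for z
    using holomorphic_derivI[OF H S that] by (simp add: has_field_derivative_def)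
  have d2: "(deriv H has_derivative (\<lambda>h. deriv (deriv H) z * h)) (at z)" if "z \<in> S" for z
    using holomorphic_derivI[OF H' S that] by (simp add: has_field_derivative_def)
  show ?thesis unfolding C2_on_def
  proof (intro exI[of _ "\<lambda>z. T (deriv H z)"] exI[of _ "\<lambda>z. U (deriv (deriv H) z)"] conjI ballI)
    fix z assume z: "z \<in> S"
    show "((\<lambda>z. A (H z)) has_derivative blinfun_apply (T (deriv H z))) (at z)"
      using bounded_linear.has_derivative[OF A d1[OF z]] by (simp add: T_apply[abs_def])
    show "((\<lambda>z. T (deriv H z)) has_derivative blinfun_apply (U (deriv (deriv H) z))) (at z)"
      using bounded_linear.has_derivative[OF T d2[OF z]] by (simp add: U_apply[abs_def])
  next
    have "bounded_linear U"
      unfolding U_def[abs_def]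
      by (intro bounded_linear_compose[OF bounded_bilinear.bounded_linear_right[OF bounded_bilinear_blinfun_compose]]
        bounded_linear_blinfun_mult_right)
    from bounded_linear.continuous_on[OF this H''] show "continuous_on S (\<lambda>z. U (deriv (deriv H) z))" .
  qed
qed

lemma partials_of_derivative:
  assumes "(h has_derivative h') (at z)"
  shows "partial_x h z = h' 1" "partial_y h z = h' \<i>"
proof -
  have lin: "linear h'" by (rule has_derivative_linear[OF assms])
  have "((\<lambda>t. h (z + c * of_real t)) has_vector_derivative h' c) (at 0)" for c
  proof -
    have "((\<lambda>t. z + c * of_real t) has_derivative (\<lambda>t. c * of_real t)) (at 0)"
      by (auto intro!: derivative_eq_intros)
    moreover have "(h has_derivative h') (at (z + c * of_real 0))" using assms by simp
    ultimately have "((\<lambda>t. h (z + c * of_real t)) has_derivative (\<lambda>t. h' (c * of_real t))) (at 0)"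
      by (rule has_derivative_compose)
    moreover have "h' (c * of_real t) = t *\<^sub>R h' c" for t :: real
      using linear_scale[OF lin, of t c] by (simp add: scaleR_conv_of_real mult.commute)
    ultimately show ?thesis by (simp add: has_vector_derivative_def)
  qed
  from vector_derivative_at[OF this[of 1]] vector_derivative_at[OF this[of \<i>]]
  show "partial_x h z = h' 1" "partial_y h z = h' \<i>"
    by (simp_all add: partial_x_def partial_y_def)
qed

lemma parts_of_bc_operators:
  assumes "(h has_derivative h') (at z)"
  shows "plus_part (bc_delbar h z) = (plus_part (h' 1) - \<i> * plus_part (h' \<i>)) / 2"
    "minus_part (bc_delbar h z) = (minus_part (h' 1) + \<i> * minus_part (h' \<i>)) / 2"
    "plus_part (bc_del h z) = (plus_part (h' 1) + \<i> * plus_part (h' \<i>)) / 2"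
    "minus_part (bc_del h z) = (minus_part (h' 1) - \<i> * minus_part (h' \<i>)) / 2"
  by (simp_all add: bc_del_def bc_delbar_def wirtinger_z_def wirtinger_zbar_def partials_of_derivative[OF assms])

text \<open>In terms of the Wirtinger derivatives, an antiholomorphic function is annihilated by
  \<open>\<partial>\<close> and a holomorphic one by \<open>\<partial>\<close>-bar. So \<open>bc_delbar f\<close> retains \<open>A'\<close> in the plus part and the derivative of the
  antiholomorphic term in the minus part, and \<open>bc_del\<close> annihilates both.\<close>
lemma bc_harmonic_of_holomorphic:
  assumes A: "A holomorphic_on ball 0 1" and B: "B holomorphic_on ball 0 1"
    and C: "C holomorphic_on ball 0 1" and E: "E holomorphic_on ball 0 1"
  defines "f \<equiv> \<lambda>z. of_parts (A z + B (cnj z)) (C z + E (cnj z))"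
  shows "C2_on (ball 0 1) f" "\<And>z. z \<in> ball 0 1 \<Longrightarrow> bc_del (bc_delbar f) z = 0"
proof -
  \<comment> \<open>An antiholomorphic term is the conjugate of a holomorphic function, and the outer conjugation can be absorbed into the real-linear map of \<open>C2_on_linear_holomorphic\<close>.\<close>
  have refl: "(cnj \<circ> H \<circ> cnj) holomorphic_on ball 0 1" if "H holomorphic_on ball 0 1" for H
  proof (rule holomorphic_onI)
    fix z :: complex assume "z \<in> ball 0 1"
    then have "(H has_field_derivative deriv H (cnj z)) (at (cnj z))"
      by (intro holomorphic_derivI[OF that open_ball]) simp
    then have "((cnj \<circ> H \<circ> cnj) has_field_derivative cnj (deriv H (cnj z))) (at z)"
      using has_field_derivative_cnj_cnj by fastforce
    then show "(cnj \<circ> H \<circ> cnj) field_differentiable (at z within ball 0 1)"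
      by (meson field_differentiable_at_within field_differentiable_def)
  qed
  note lin = bounded_linear_of_parts
  have "C2_on (ball 0 1) (\<lambda>z. (of_parts (A z) 0 + of_parts (cnj ((cnj \<circ> B \<circ> cnj) z)) 0) +
          (of_parts 0 (C z) + of_parts 0 (cnj ((cnj \<circ> E \<circ> cnj) z))))"
    by (intro C2_on_add open_ball
        C2_on_linear_holomorphic[OF lin(1) A]  C2_on_linear_holomorphic[OF lin(2) C]
        C2_on_linear_holomorphic[OF bounded_linear_compose[OF lin(1) bounded_linear_cnj] refl[OF B]]
        C2_on_linear_holomorphic[OF bounded_linear_compose[OF lin(2) bounded_linear_cnj] refl[OF E]])
  moreover have "(\<lambda>z. (of_parts (A z) 0 + of_parts (cnj ((cnj \<circ> B \<circ> cnj) z)) 0) +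
          (of_parts 0 (C z) + of_parts 0 (cnj ((cnj \<circ> E \<circ> cnj) z)))) = f"
    by (auto simp: f_def bicomplex_eq_iff_parts)
  ultimately show "C2_on (ball 0 1) f" by simp
  have d: "(H has_derivative (\<lambda>h. deriv H z * h)) (at z)"
    if "H holomorphic_on ball 0 1" "z \<in> ball 0 1" for H z
    using holomorphic_derivI[OF that(1) open_ball that(2)] by (simp add: has_field_derivative_def)
  have dc: "((\<lambda>z. H (cnj z)) has_derivative (\<lambda>h. deriv H (cnj z) * cnj h)) (at z)"
    if "H holomorphic_on ball 0 1" "z \<in> ball 0 1" for H z
    using has_derivative_compose[OF has_derivative_cnj[OF has_derivative_ident] d[OF that(1), of "cnj z"]] that(2)
    by simp
  have delbar: "of_parts (deriv A z) (deriv E (cnj z)) = bc_delbar f z" if z: "z \<in> ball 0 1" for z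
  proof -
    have "(f has_derivative (\<lambda>h. of_parts (deriv A z * h + deriv B (cnj z) * cnj h) (deriv C z * h + deriv E (cnj z) * cnj h))) (at z)"
      unfolding f_def by (intro has_derivative_of_parts has_derivative_add d dc A B C E z)
    from parts_of_bc_operators(1,2)[OF this] show ?thesis
      by (simp add: bicomplex_eq_iff_parts field_simps)
  qed
  fix z :: complex assume z: "z \<in> ball 0 1"
  have "((\<lambda>z. of_parts (deriv A z) (deriv E (cnj z))) has_derivative
      (\<lambda>h. of_parts (deriv (deriv A) z * h) (deriv (deriv E) (cnj z) * cnj h))) (at z)"
    by (intro has_derivative_of_parts d dc holomorphic_deriv open_ball A E z)
  then have "(bc_delbar f has_derivative
      (\<lambda>h. of_parts (deriv (deriv A) z * h) (deriv (deriv E) (cnj z) * cnj h))) (at z)"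
    by (rule has_derivative_transform_within_open[OF _ open_ball z]) (rule delbar)
  from parts_of_bc_operators(3,4)[OF this] show "bc_del (bc_delbar f) z = 0"
    by (simp add: bicomplex_eq_iff_parts algebra_simps)
qed

text \<open>The plus part satisfies \<open>\<partial>\<close>-bar \<open>\<partial> u = 0\<close>, the hypothesis of
  \<open>harmonic_decomposition\<close>. On the minus part the operators come in the opposite order.
  Composition with conjugation interchanges them, which reduces the minus part to the same lemma
  at the price of swapping the two power series.\<close>
lemma bc_harmonic_parts:
  assumes C2: "C2_on (ball 0 1) h" and harm: "\<And>z. z \<in> ball 0 1 \<Longrightarrow> bc_del (bc_delbar h) z = 0"
  shows "\<exists>a b. disk_summable a \<and> disk_summable b \<and> (\<forall>z\<in>ball 0 1. plus_part (h z) = disk_series a b z)"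
    and "\<exists>a b. disk_summable a \<and> disk_summable b \<and> (\<forall>z\<in>ball 0 1. minus_part (h z) = disk_series a b z)"
proof -
  obtain h' h'' where h': "\<And>z. z \<in> ball 0 1 \<Longrightarrow> (h has_derivative blinfun_apply (h' z)) (at z)"
    and h'': "\<And>z. z \<in> ball 0 1 \<Longrightarrow> (h' has_derivative blinfun_apply (h'' z)) (at z)"
    using C2 unfolding C2_on_def by blast
  note plus = bounded_linear_parts(1) and minus = bounded_linear_parts(2)
  define p where "p z = plus_part (h' z 1) - \<i> * plus_part (h' z \<i>)" for z
  define q where "q z = minus_part (h' z 1) + \<i> * minus_part (h' z \<i>)" for z
  define p' where "p' z k = plus_part (h'' z k 1) - \<i> * plus_part (h'' z k \<i>)" for z k
  define q' where "q' z k = minus_part (h'' z k 1) + \<i> * minus_part (h'' z k \<i>)" for z k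
  have ev: "((\<lambda>z. h' z c) has_derivative (\<lambda>k. h'' z k c)) (at z)" if "z \<in> ball 0 1" for z c
    using bounded_linear.has_derivative[OF bounded_bilinear.bounded_linear_left[OF bounded_bilinear_blinfun_apply] h''[OF that]] .
  have p: "(p has_derivative p' z) (at z)" if "z \<in> ball 0 1" for z
    unfolding p_def[abs_def] p'_def[abs_def]
    by (intro has_derivative_diff has_derivative_mult_right bounded_linear.has_derivative[OF plus] ev that)
  have q: "(q has_derivative q' z) (at z)" if "z \<in> ball 0 1" for z
    unfolding q_def[abs_def] q'_def[abs_def]
    by (intro has_derivative_add has_derivative_mult_right bounded_linear.has_derivative[OF minus] ev that)
  have delbar: "of_parts (p z / 2) (q z / 2) = bc_delbar h z" if "z \<in> ball 0 1" for z
    using parts_of_bc_operators(1,2)[OF h'[OF that]] by (simp add: bicomplex_eq_iff_parts p_def q_def)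
  have zero: "p' z 1 + \<i> * p' z \<i> = 0" "q' z 1 - \<i> * q' z \<i> = 0" if z: "z \<in> ball 0 1" for z
  proof -
    have "((\<lambda>z. of_parts (p z / 2) (q z / 2)) has_derivative (\<lambda>k. of_parts (p' z k / 2) (q' z k / 2))) (at z)"
      by (intro has_derivative_of_parts bounded_linear.has_derivative[OF bounded_linear_divide] p q z)
    then have "(bc_delbar h has_derivative (\<lambda>k. of_parts (p' z k / 2) (q' z k / 2))) (at z)"
      by (rule has_derivative_transform_within_open[OF _ open_ball z]) (rule delbar)
    from parts_of_bc_operators(3,4)[OF this] harm[OF z]
    show "p' z 1 + \<i> * p' z \<i> = 0" "q' z 1 - \<i> * q' z \<i> = 0" by (simp_all add: field_simps)
  qed
  show "\<exists>a b. disk_summable a \<and> disk_summable b \<and> (\<forall>z\<in>ball 0 1. plus_part (h z) = disk_series a b z)"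
  proof (rule harmonic_decomposition)
    fix z :: complex assume z: "z \<in> ball 0 1"
    show "((\<lambda>z. plus_part (h z)) has_derivative (\<lambda>k. plus_part (h' z k))) (at z)"
      by (rule bounded_linear.has_derivative[OF plus h'[OF z]])
    show "((\<lambda>z. plus_part (h' z 1) - \<i> * plus_part (h' z \<i>)) has_derivative p' z) (at z)"
      using p[OF z] by (simp add: p_def[abs_def])
    show "p' z 1 + \<i> * p' z \<i> = 0" by (rule zero[OF z])
  qed blast
  have "\<exists>a b. disk_summable a \<and> disk_summable b \<and> (\<forall>z\<in>ball 0 1. minus_part (h (cnj z)) = disk_series a b z)"
  proof (rule harmonic_decomposition)
    fix z :: complex assume "z \<in> ball 0 1"
    then have z: "cnj z \<in> ball 0 1" by simp
    show "((\<lambda>z. minus_part (h (cnj z))) has_derivative (\<lambda>k. minus_part (h' (cnj z) (cnj k)))) (at z)"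
      using has_derivative_compose[OF has_derivative_cnj[OF has_derivative_ident] bounded_linear.has_derivative[OF minus h'[OF z]]] .
    have neg: "minus_part (h' w (- \<i>)) = - minus_part (h' w \<i>)" for w
      by (simp add: blinfun.minus_right minus_part_eq)
    have "((\<lambda>z. q (cnj z)) has_derivative (\<lambda>k. q' (cnj z) (cnj k))) (at z)"
      using has_derivative_compose[OF has_derivative_cnj[OF has_derivative_ident] q[OF z]] .
    then show "((\<lambda>z. minus_part (h' (cnj z) (cnj 1)) - \<i> * minus_part (h' (cnj z) (cnj \<i>))) has_derivative (\<lambda>k. q' (cnj z) (cnj k))) (at z)"
      by (simp add: q_def[abs_def] neg)
    have "q' (cnj z) (- \<i>) = - q' (cnj z) \<i>"
      by (rule linear_neg[OF has_derivative_linear[OF q[OF z]]])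
    then show "q' (cnj z) (cnj 1) + \<i> * q' (cnj z) (cnj \<i>) = 0"
      using zero(2)[OF z] by simp
  qed blast
  then obtain a b where ab: "disk_summable a" "disk_summable b" "\<And>z. z \<in> ball 0 1 \<Longrightarrow> minus_part (h (cnj z)) = disk_series a b z"
    by blast
  have "minus_part (h z) = disk_series b a z" if "z \<in> ball 0 1" for z
    using ab(3)[of "cnj z"] that by (simp add: disk_series_def)
  with ab(1,2) show "\<exists>a b. disk_summable a \<and> disk_summable b \<and> (\<forall>z\<in>ball 0 1. minus_part (h z) = disk_series a b z)"
    by blast
qed

section \<open>Boundary values and the Dirichlet problem\<close>

text \<open>The image under \<open>P\<close> of a function that is not integrable may be integrable, so \<open>P\<close> passes
  through the integral only because \<open>has_boundary_value\<close> demands integrability near \<open>r = 1\<close>.\<close>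
lemma boundary_value_part:
  assumes h: "has_boundary_value h g" and \<gamma>: "\<gamma> \<in> circle_test"
    and P: "bounded_linear P" "\<And>z c. P (z *\<^sub>B bc c) = P z * c"
  shows "((\<lambda>r. integral {0..2*pi} (\<lambda>\<theta>. P (h (of_real r * cis \<theta>)) * \<gamma> \<theta>)) \<longlongrightarrow> P (g \<gamma>)) (at_left (1::real))"
proof (rule Lim_transform_eventually)
  show "((\<lambda>r. P (integral {0..2*pi} (\<lambda>\<theta>. h (of_real r * cis \<theta>) *\<^sub>B bc (\<gamma> \<theta>)))) \<longlongrightarrow> P (g \<gamma>)) (at_left (1::real))"
    using h \<gamma> by (intro bounded_linear.tendsto[OF P(1)]) (simp add: has_boundary_value_def)
  have "\<forall>\<^sub>F r in at_left (1::real). (\<lambda>\<theta>. h (of_real r * cis \<theta>) *\<^sub>B bc (\<gamma> \<theta>)) absolutely_integrable_on {0..2*pi}"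
    using h \<gamma> by (simp add: has_boundary_value_def)
  then show "\<forall>\<^sub>F r in at_left (1::real). P (integral {0..2*pi} (\<lambda>\<theta>. h (of_real r * cis \<theta>) *\<^sub>B bc (\<gamma> \<theta>))) =
      integral {0..2*pi} (\<lambda>\<theta>. P (h (of_real r * cis \<theta>)) * \<gamma> \<theta>)"
  proof eventually_elim
    case (elim r)
    from integral_linear[OF set_lebesgue_integral_eq_integral(1)[OF elim] P(1)]
    show ?case by (simp add: o_def P(2))
  qed
qed

lemma boundary_value_of_parts:
  assumes "circle_distribution (\<lambda>\<phi>. plus_part (g \<phi>))" "circle_distribution (\<lambda>\<phi>. minus_part (g \<phi>))"
  shows "has_boundary_value (\<lambda>z. of_parts (poisson_extension (\<lambda>\<phi>. plus_part (g \<phi>)) z) (poisson_extension (\<lambda>\<phi>. minus_part (g \<phi>)) z)) g"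
    (is "has_boundary_value (\<lambda>z. of_parts (?U z) (?V z)) g")
  unfolding has_boundary_value_def
proof (intro ballI conjI)
  fix \<gamma> assume \<gamma>: "\<gamma> \<in> circle_test"
  have prod: "of_parts a b *\<^sub>B bc c = of_parts (a * c) (b * c)" for a b c
    by (simp add: bicomplex_eq_iff_parts)
  have cont: "continuous_on {0..2*pi} (\<lambda>\<theta>. of_parts (?U (of_real r * cis \<theta>) * \<gamma> \<theta>) (?V (of_real r * cis \<theta>) * \<gamma> \<theta>))"
    if "0 \<le> r" "r < 1" for r
    by (intro continuous_on_of_parts continuous_on_mult continuous_on_disk_series_circle
        circle_test_continuous[OF \<gamma>] disk_summable_coeff assms that)
  have ev: "\<forall>\<^sub>F r in at_left (1::real). 0 \<le> r \<and> r < 1"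
    using eventually_at_left_real[of 0 1, OF zero_less_one] by eventually_elim auto
  then show "\<forall>\<^sub>F r in at_left 1. (\<lambda>\<theta>. of_parts (?U (of_real r * cis \<theta>)) (?V (of_real r * cis \<theta>)) *\<^sub>B bc (\<gamma> \<theta>))
      absolutely_integrable_on {0..2*pi}"
    unfolding prod by eventually_elim (intro absolutely_integrable_continuous_real cont, auto)
  have "((\<lambda>r. of_parts (integral {0..2*pi} (\<lambda>\<theta>. ?U (of_real r * cis \<theta>) * \<gamma> \<theta>)) (integral {0..2*pi} (\<lambda>\<theta>. ?V (of_real r * cis \<theta>) * \<gamma> \<theta>)))
      \<longlongrightarrow> of_parts (plus_part (g \<gamma>)) (minus_part (g \<gamma>))) (at_left 1)"
    by (intro tendsto_of_parts poisson_extension_boundary[OF _ \<gamma>] assms)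
  moreover have "\<forall>\<^sub>F r in at_left (1::real). of_parts (integral {0..2*pi} (\<lambda>\<theta>. ?U (of_real r * cis \<theta>) * \<gamma> \<theta>)) (integral {0..2*pi} (\<lambda>\<theta>. ?V (of_real r * cis \<theta>) * \<gamma> \<theta>))
     = integral {0..2*pi} (\<lambda>\<theta>. of_parts (?U (of_real r * cis \<theta>)) (?V (of_real r * cis \<theta>)) *\<^sub>B bc (\<gamma> \<theta>))"
    using ev
  proof eventually_elim
    case (elim r)
    then have "(\<lambda>\<theta>. of_parts (?U (of_real r * cis \<theta>) * \<gamma> \<theta>) (?V (of_real r * cis \<theta>) * \<gamma> \<theta>)) integrable_on {0..2*pi}"
      by (intro integrable_continuous_real cont) auto
    from integral_linear[OF this bounded_linear_parts(1)] integral_linear[OF this bounded_linear_parts(2)]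
    show ?case unfolding prod by (simp add: o_def bicomplex_eq_iff_parts)
  qed
  ultimately show "((\<lambda>r. integral {0..2*pi} (\<lambda>\<theta>. of_parts (?U (of_real r * cis \<theta>)) (?V (of_real r * cis \<theta>)) *\<^sub>B bc (\<gamma> \<theta>)))
      \<longlongrightarrow> g \<gamma>) (at_left 1)"
    unfolding of_parts_parts by (rule Lim_transform_eventually)
qed

text \<open>Among all test functions, the oscillations \<open>osc m\<close> suffice to identify the series.\<close>
lemma poisson_extension_unique:
  assumes L: "circle_distribution L" and a: "disk_summable a" and b: "disk_summable b"
    and u: "\<And>z. z \<in> ball 0 1 \<Longrightarrow> u z = disk_series a b z"
    and lim: "\<And>\<gamma>. \<gamma> \<in> circle_test \<Longrightarrow>
      ((\<lambda>r. integral {0..2*pi} (\<lambda>\<theta>. u (of_real r * cis \<theta>) * \<gamma> \<theta>)) \<longlongrightarrow> L \<gamma>) (at_left (1::real))"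
    and z: "z \<in> ball 0 1"
  shows "u z = poisson_extension L z"
  unfolding u[OF z]
proof (rule disk_series_unique[OF a b disk_summable_coeff[OF L] _ _ z])
  fix m
  show "((\<lambda>r. integral {0..2*pi} (\<lambda>\<theta>. poisson_extension L (of_real r * cis \<theta>) * osc m \<theta>)) \<longlongrightarrow> L (osc m)) (at_left 1)"
    by (rule poisson_extension_boundary[OF L osc_circle_test])
  show "((\<lambda>r. integral {0..2*pi} (\<lambda>\<theta>. disk_series a b (of_real r * cis \<theta>) * osc m \<theta>)) \<longlongrightarrow> L (osc m)) (at_left 1)"
  proof (rule Lim_transform_eventually[OF lim[OF osc_circle_test]])
    show "\<forall>\<^sub>F r in at_left (1::real). integral {0..2*pi} (\<lambda>\<theta>. u (of_real r * cis \<theta>) * osc m \<theta>) =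
       integral {0..2*pi} (\<lambda>\<theta>. disk_series a b (of_real r * cis \<theta>) * osc m \<theta>)"
      using eventually_at_left_real[of 0 1, OF zero_less_one]
    proof eventually_elim
      case (elim r)
      then have "u (of_real r * cis \<theta>) = disk_series a b (of_real r * cis \<theta>)" for \<theta>
        by (intro u) (simp add: norm_mult)
      then show ?case by simp
    qed
  qed
qed

theorem corollary4p3:
  fixes g :: "(real \<Rightarrow> complex) \<Rightarrow> bicomplex"
  assumes "bc_distribution g"
  shows "\<exists>f :: complex \<Rightarrow> bicomplex.
           bc_dirichlet_solution g f \<and>
           (\<forall>r \<theta>. 0 \<le> r \<longrightarrow> r < 1 \<longrightarrow>
              f (complex_of_real r * cis \<theta>) =
                p_plus *\<^sub>B bc (1 / (2 * pi) *
                   plus_part (g (\<lambda>t. complex_of_real (poisson_kernel r (\<theta> - t))))) +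
                p_minus *\<^sub>B bc (1 / (2 * pi) *
                   minus_part (g (\<lambda>t. complex_of_real (poisson_kernel r (\<theta> - t)))))) \<and>
           (\<forall>h. bc_dirichlet_solution g h \<longrightarrow> (\<forall>z\<in>ball 0 1. h z = f z))"
proof -
  let ?L = "\<lambda>\<phi>. plus_part (g \<phi>)" and ?M = "\<lambda>\<phi>. minus_part (g \<phi>)"
  note L = circle_distribution_parts(1)[OF assms] and M = circle_distribution_parts(2)[OF assms]
  define f where "f z = of_parts (poisson_extension ?L z) (poisson_extension ?M z)" for z
  note holo = holomorphic_on_disk_series[OF disk_summable_coeff(1)] holomorphic_on_disk_series[OF disk_summable_coeff(2)]
  note harm = bc_harmonic_of_holomorphic[OF holo(1)[OF L] holo(2)[OF L] holo(1)[OF M] holo(2)[OF M]]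
  have sol: "bc_dirichlet_solution g f"
    unfolding bc_dirichlet_solution_def
  proof (intro conjI ballI)
    show "C2_on (ball 0 1) f" using harm(1) by (simp add: f_def[abs_def] disk_series_def)
    show "bc_del (bc_delbar f) z = 0" if "z \<in> ball 0 1" for z
      using harm(2)[OF that] by (simp add: f_def[abs_def] disk_series_def)
    show "has_boundary_value f g" unfolding f_def[abs_def] by (rule boundary_value_of_parts[OF L M])
  qed
  have formula: "f (complex_of_real r * cis \<theta>) =
                p_plus *\<^sub>B bc (1 / (2 * pi) * ?L (\<lambda>t. complex_of_real (poisson_kernel r (\<theta> - t)))) +
                p_minus *\<^sub>B bc (1 / (2 * pi) * ?M (\<lambda>t. complex_of_real (poisson_kernel r (\<theta> - t))))"
    if "0 \<le> r" "r < 1" for r \<theta>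
    unfolding f_def of_parts_def poisson_extension_eq[OF L that] poisson_extension_eq[OF M that] by simp
  have unique: "h z = f z" if h: "bc_dirichlet_solution g h" and z: "z \<in> ball 0 1" for h z
  proof -
    have C2: "C2_on (ball 0 1) h" and del: "\<And>z. z \<in> ball 0 1 \<Longrightarrow> bc_del (bc_delbar h) z = 0"
      and bv: "has_boundary_value h g" using h by (auto simp: bc_dirichlet_solution_def)
    obtain a b where ab: "disk_summable a" "disk_summable b" "\<And>z. z \<in> ball 0 1 \<Longrightarrow> plus_part (h z) = disk_series a b z"
      using bc_harmonic_parts(1)[OF C2 del] by blast
    obtain c d where cd: "disk_summable c" "disk_summable d" "\<And>z. z \<in> ball 0 1 \<Longrightarrow> minus_part (h z) = disk_series c d z"
      using bc_harmonic_parts(2)[OF C2 del] by blast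
    have "plus_part (h z) = poisson_extension ?L z"
      by (rule poisson_extension_unique[where u = "\<lambda>z. plus_part (h z)", OF L ab boundary_value_part[OF bv _ bounded_linear_parts(1)] z]) simp_all
    moreover have "minus_part (h z) = poisson_extension ?M z"
      by (rule poisson_extension_unique[where u = "\<lambda>z. minus_part (h z)", OF M cd boundary_value_part[OF bv _ bounded_linear_parts(2)] z]) simp_all
    ultimately show ?thesis by (simp add: bicomplex_eq_iff_parts f_def)
  qed
  show ?thesis
    by (rule exI[of _ f], intro conjI allI impI ballI) (fact sol, erule (1) formula, erule (1) unique)
qed

end
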